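(* The divergence of a finitely presented one-ended group is at most exponential; i.e. if $G$ is a finitely presented one-ended group then $Div^G(n)\preceq e^n$.
   Context: Let $X$ be a metric space, $0<\delta<1$, $\gamma\ge0$. For $a,b,c\in X$ with $d(c,\{a,b\})=r>0$, $div_\gamma(a,b,c;\delta)$ is the infimum of the lengths of paths connecting $a,b$ that avoid $B(c,\delta r-\gamma)$ (and $\infty$ if there is no such path). $Div^X_\gamma(n,\delta)$ is the supremum of all $div_\gamma(a,b,c;\delta)$ with $d(a,b)\le n$. For functions $f,g$ on $\mathbb{R}^+$ write $f\preceq g$ if there is $C$ with $f(n)\le Cg(Cn+C)+Cn+C$ for all $n$; $f\asymp g$ means $f\preceq g$ and $g\preceq f$. There exist $\delta_0,\gamma_0$ such that for $X$ a Cayley graph (with respect to a finite generating set) $Div^X_\gamma(n,\delta)\asymp Div^X_{\gamma_0}(n,\delta_0)$ whenever $0<\delta\le\delta_0$, $\gamma\ge\gamma_0$, and the $\asymp$-class is a quasi-isometry invariant of Cayley graphs. $Div^G(n)$ denotes (the $\asymp$-class of) $Div^X_{\gamma_0}(n,\delta_0)$ for $X$ a Cayley graph of $G$. *)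

theory Defs
  imports "HOL-Analysis.Analysis" "HOL-Algebra.Generated_Groups"
begin

section \<open>Divergence of a metric space\<close>

text \<open>Lengths and divergence take the value \<open>\<infinity>\<close>, so they live in \<^typ>\<open>ennreal\<close>. Balls of nonpositive
  radius are empty, and the infimum of the empty set is \<open>\<infinity>\<close>.\<close>

context Metric_space
begin

definition path_length :: "(real \<Rightarrow> 'a) \<Rightarrow> ennreal" where
  "path_length p = (SUP (k, t) \<in> {(k::nat, t::nat \<Rightarrow> real). mono t \<and> range t \<subseteq> {0..1}}.
      \<Sum>i<k. ennreal (d (p (t i)) (p (t (Suc i)))))"

definition div3 :: "real \<Rightarrow> 'a \<Rightarrow> 'a \<Rightarrow> 'a \<Rightarrow> real \<Rightarrow> ennreal" where
  "div3 \<gamma> a b c \<delta> =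
     (INF p \<in> {p. pathin mtopology p \<and> p 0 = a \<and> p 1 = b \<and>
                 p ` {0..1} \<inter> mball c (\<delta> * min (d c a) (d c b) - \<gamma>) = {}}. path_length p)"

definition Div :: "real \<Rightarrow> real \<Rightarrow> real \<Rightarrow> ennreal" where
  "Div \<gamma> \<delta> n =
     (SUP (a, b, c) \<in> {(a, b, c). a \<in> M \<and> b \<in> M \<and> c \<in> M \<and> 0 < min (d c a) (d c b) \<and> d a b \<le> n}.
        div3 \<gamma> a b c \<delta>)"

definition one_ended :: bool where
  "one_ended \<longleftrightarrow> (\<forall>K. compactin mtopology K \<longrightarrow>
     (\<exists>!C. C \<in> connected_components_of (subtopology mtopology (M - K)) \<and> \<not> mbounded C))"

end

text \<open>Functions on the nonnegative reals; \<open>C > 0\<close> keeps the argument \<open>C * n + C\<close> in their domain.\<close>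

definition preceq :: "(real \<Rightarrow> ennreal) \<Rightarrow> (real \<Rightarrow> ennreal) \<Rightarrow> bool"  (infix \<open>\<preceq>\<close> 50) where
  "f \<preceq> g \<longleftrightarrow> (\<exists>C>0. \<forall>n\<ge>0. f n \<le> ennreal C * g (C * n + C) + ennreal (C * n + C))"

definition asympeq :: "(real \<Rightarrow> ennreal) \<Rightarrow> (real \<Rightarrow> ennreal) \<Rightarrow> bool"  (infix \<open>\<asymp>\<close> 50) where
  "f \<asymp> g \<longleftrightarrow> f \<preceq> g \<and> g \<preceq> f"


section \<open>Cayley graphs as metric graphs\<close>

definition finite_generating_set :: "('a, 'b) monoid_scheme \<Rightarrow> 'a set \<Rightarrow> bool" where
  "finite_generating_set G S \<longleftrightarrow> finite S \<and> S \<subseteq> carrier G \<and> generate G S = carrier G"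

text \<open>A point of the geometric realization is given by its barycentric coordinates, a function on the
  vertices: the vertex \<open>u\<close> is the indicator function of \<open>{u}\<close>. The Cayley graph is
  a simple graph: \<open>segment u u\<close> is just a vertex, so generators equal to \<open>\<one>\<close> contribute no loops.\<close>

definition segment :: "'a \<Rightarrow> 'a \<Rightarrow> ('a \<Rightarrow> real) set" where
  "segment u v = {\<lambda>w. (1 - t) * indicator {u} w + t * indicator {v} w | t. 0 \<le> t \<and> t \<le> 1}"

definition cayley_cells :: "('a, 'b) monoid_scheme \<Rightarrow> 'a set \<Rightarrow> ('a \<Rightarrow> real) set set" where
  "cayley_cells G S = {segment u u | u. u \<in> carrier G} \<union>
     {segment u (u \<otimes>\<^bsub>G\<^esub> s) | u s. u \<in> carrier G \<and> s \<in> S}"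

definition cayley_space :: "('a, 'b) monoid_scheme \<Rightarrow> 'a set \<Rightarrow> ('a \<Rightarrow> real) set" where
  "cayley_space G S = \<Union> (cayley_cells G S)"

text \<open>Within one edge, the points with parameters \<open>t\<close> and \<open>t'\<close> are at distance \<open>\<bar>t - t'\<bar>\<close>.\<close>

definition cell_dist :: "('a \<Rightarrow> real) \<Rightarrow> ('a \<Rightarrow> real) \<Rightarrow> real" where
  "cell_dist x y = (SUP w. \<bar>x w - y w\<bar>)"

definition cell_chains ::
  "('a, 'b) monoid_scheme \<Rightarrow> 'a set \<Rightarrow> ('a \<Rightarrow> real) \<Rightarrow> ('a \<Rightarrow> real) \<Rightarrow> (nat \<times> (nat \<Rightarrow> 'a \<Rightarrow> real)) set" where
  "cell_chains G S x y = {(k, p). p 0 = x \<and> p k = y \<and>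
     (\<forall>i<k. \<exists>e \<in> cayley_cells G S. p i \<in> e \<and> p (Suc i) \<in> e)}"

text \<open>The path metric with all edges of length 1: the infimum of the lengths of piecewise linear
  paths. The value 0 outside the graph is a dummy, needed for \<^locale>\<open>Metric_space\<close>.\<close>

definition cayley_dist :: "('a, 'b) monoid_scheme \<Rightarrow> 'a set \<Rightarrow> ('a \<Rightarrow> real) \<Rightarrow> ('a \<Rightarrow> real) \<Rightarrow> real" where
  "cayley_dist G S x y = (if x \<in> cayley_space G S \<and> y \<in> cayley_space G S
     then INF (k, p) \<in> cell_chains G S x y. \<Sum>i<k. cell_dist (p i) (p (Suc i)) else 0)"

lemma cell_bdd:
  assumes "e \<in> cayley_cells G S" "x \<in> e"
  shows "0 \<le> x w" "x w \<le> 1"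
  using assms by (auto simp: cayley_cells_def segment_def indicator_def)

lemma cell_dist_ge:
  assumes "x \<in> cayley_space G S" "y \<in> cayley_space G S"
  shows "\<bar>x w - y w\<bar> \<le> cell_dist x y"
proof -
  have "\<bar>x w - y w\<bar> \<le> 1" for w
    using assms cell_bdd[of _ G S x w] cell_bdd[of _ G S y w]
    unfolding cayley_space_def by fastforce
  then show ?thesis
    unfolding cell_dist_def by (intro cSUP_upper bdd_aboveI2[where M = 1]) auto
qed

lemma cell_dist_segment:
  assumes "u \<noteq> v"
  shows "cell_dist (\<lambda>w. (1 - t) * indicator {u} w + t * indicator {v} w)
                   (\<lambda>w. (1 - t') * indicator {u} w + t' * indicator {v} w) = \<bar>t - t'\<bar>"
  unfolding cell_dist_def
proof (intro antisym cSUP_least)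
  show *: "\<bar>(1 - t) * indicator {u} w + t * indicator {v} w
          - ((1 - t') * indicator {u} w + t' * indicator {v} w)\<bar> \<le> \<bar>t - t'\<bar>" for w
    using assms by (auto simp: indicator_def)
  show "\<bar>t - t'\<bar> \<le> (SUP w. \<bar>(1 - t) * indicator {u} w + t * indicator {v} w
          - ((1 - t') * indicator {u} w + t' * indicator {v} w)\<bar>)"
  proof (rule cSUP_upper2)
    show "bdd_above (range (\<lambda>w. \<bar>(1 - t) * indicator {u} w + t * indicator {v} w
          - ((1 - t') * indicator {u} w + t' * indicator {v} w)\<bar>))"
      by (rule bdd_aboveI2[OF *])
    show "\<bar>t - t'\<bar> \<le> \<bar>(1 - t) * indicator {u} v + t * indicator {v} v
          - ((1 - t') * indicator {u} v + t' * indicator {v} v)\<bar>"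
      using assms by simp
  qed simp
qed simp

lemma cell_dist_commute: "cell_dist x y = cell_dist y x"
  by (simp add: cell_dist_def abs_minus_commute)

lemma cell_chains_rev:
  assumes "(k, p) \<in> cell_chains G S x y"
  shows "(k, \<lambda>i. p (k - i)) \<in> cell_chains G S y x"
    and "(\<Sum>i<k. cell_dist (p (k - i)) (p (k - Suc i))) = (\<Sum>i<k. cell_dist (p i) (p (Suc i)))"
proof -
  have "\<exists>e \<in> cayley_cells G S. p (k - i) \<in> e \<and> p (k - Suc i) \<in> e" if "i < k" for i
  proof -
    have "Suc (k - Suc i) = k - i" "k - Suc i < k" using that by auto
    with assms show ?thesis unfolding cell_chains_def by (smt (verit) mem_Collect_eq case_prod_conv)
  qed
  with assms show "(k, \<lambda>i. p (k - i)) \<in> cell_chains G S y x"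
    by (auto simp: cell_chains_def)
  have "(\<Sum>i<k. cell_dist (p i) (p (Suc i))) = (\<Sum>i<k. cell_dist (p (k - Suc i)) (p (Suc (k - Suc i))))"
    by (rule sum.nat_diff_reindex[symmetric])
  also have "\<dots> = (\<Sum>i<k. cell_dist (p (k - i)) (p (k - Suc i)))"
    by (rule sum.cong) (auto simp: Suc_diff_Suc cell_dist_commute)
  finally show "(\<Sum>i<k. cell_dist (p (k - i)) (p (k - Suc i))) = (\<Sum>i<k. cell_dist (p i) (p (Suc i)))" ..
qed

lemma cell_chains_append:
  assumes "(k, p) \<in> cell_chains G S x y" "(l, q) \<in> cell_chains G S y z"
  defines "r \<equiv> \<lambda>i. if i \<le> k then p i else q (i - k)"
  shows "(k + l, r) \<in> cell_chains G S x z"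
    and "(\<Sum>i<k + l. cell_dist (r i) (r (Suc i)))
       = (\<Sum>i<k. cell_dist (p i) (p (Suc i))) + (\<Sum>i<l. cell_dist (q i) (q (Suc i)))"
proof -
  have *: "p 0 = x" "p k = y" "q 0 = y" "q l = z"
    "\<And>i. i < k \<Longrightarrow> \<exists>e \<in> cayley_cells G S. p i \<in> e \<and> p (Suc i) \<in> e"
    "\<And>i. i < l \<Longrightarrow> \<exists>e \<in> cayley_cells G S. q i \<in> e \<and> q (Suc i) \<in> e"
    using assms(1,2) by (simp_all add: cell_chains_def)
  have pq: "p k = q 0" using * by simp
  have lo: "r i = p i" "r (Suc i) = p (Suc i)" if "i < k" for i using that by (auto simp: r_def)
  have hi: "r (k + i) = q i" for i using pq by (auto simp: r_def)
  have hi': "r (Suc (k + i)) = q (Suc i)" for i using hi[of "Suc i"] by simp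
  have "\<exists>e \<in> cayley_cells G S. r i \<in> e \<and> r (Suc i) \<in> e" if "i < k + l" for i
  proof (cases "i < k")
    case True then show ?thesis using *(5)[OF True] lo by simp
  next
    case False
    then have j: "i = k + (i - k)" "i - k < l" using that by auto
    show ?thesis using *(6)[OF j(2)] hi[of "i - k"] hi'[of "i - k"] j(1) by simp
  qed
  moreover have "r 0 = x" "r (k + l) = z" using * hi[of l] lo(1)[of 0] hi[of 0] by (cases "k = 0"; simp)+
  ultimately show "(k + l, r) \<in> cell_chains G S x z" by (simp add: cell_chains_def)
  show "(\<Sum>i<k + l. cell_dist (r i) (r (Suc i)))
       = (\<Sum>i<k. cell_dist (p i) (p (Suc i))) + (\<Sum>i<l. cell_dist (q i) (q (Suc i)))"
  proof -
    have "(\<Sum>i<k + m. cell_dist (r i) (r (Suc i)))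
       = (\<Sum>i<k. cell_dist (p i) (p (Suc i))) + (\<Sum>i<m. cell_dist (q i) (q (Suc i)))" for m
    proof (induction m)
      case 0
      have "(\<Sum>i<k. cell_dist (r i) (r (Suc i))) = (\<Sum>i<k. cell_dist (p i) (p (Suc i)))"
        by (rule sum.cong) (use lo in auto)
      then show ?case by simp
    next
      case (Suc m)
      then show ?case by (simp only: hi hi' add_Suc_right sum.lessThan_Suc add.assoc)
    qed
    then show ?thesis .
  qed
qed

lemma cell_subset: "e \<in> cayley_cells G S \<Longrightarrow> e \<subseteq> cayley_space G S"
  by (auto simp: cayley_space_def)

lemma chain_ge:
  assumes "(k, p) \<in> cell_chains G S x y"
  shows "\<bar>x w - y w\<bar> \<le> (\<Sum>i<k. cell_dist (p i) (p (Suc i)))"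
proof -
  have "\<bar>p 0 w - p m w\<bar> \<le> (\<Sum>i<m. cell_dist (p i) (p (Suc i)))" if "m \<le> k" for m
    using that
  proof (induction m)
    case (Suc m)
    then obtain e where "e \<in> cayley_cells G S" "p m \<in> e" "p (Suc m) \<in> e"
      using assms by (auto simp: cell_chains_def Suc_le_eq)
    then have "\<bar>p m w - p (Suc m) w\<bar> \<le> cell_dist (p m) (p (Suc m))"
      using cell_subset by (intro cell_dist_ge) auto
    with Suc show ?case by simp
  qed simp
  from this[of k] assms show ?thesis by (auto simp: cell_chains_def)
qed

lemma chain_nonneg: "(k, p) \<in> cell_chains G S x y \<Longrightarrow> 0 \<le> (\<Sum>i<k. cell_dist (p i) (p (Suc i)))"
  by (rule order_trans[OF abs_ge_zero chain_ge])

lemma cayley_dist_le: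
  assumes "(k, p) \<in> cell_chains G S x y" "x \<in> cayley_space G S" "y \<in> cayley_space G S"
  shows "cayley_dist G S x y \<le> (\<Sum>i<k. cell_dist (p i) (p (Suc i)))"
proof -
  have "(INF (k, p) \<in> cell_chains G S x y. \<Sum>i<k. cell_dist (p i) (p (Suc i)))
      \<le> (\<Sum>i<k. cell_dist (p i) (p (Suc i)))"
    by (rule cINF_lower2[OF _ assms(1)]) (auto intro!: bdd_belowI2[where m = 0] chain_nonneg)
  with assms(2,3) show ?thesis by (simp add: cayley_dist_def)
qed

lemma chain_step:
  assumes "e \<in> cayley_cells G S" "x \<in> e" "y \<in> e"
  shows "(1, \<lambda>i. if i = 0 then x else y) \<in> cell_chains G S x y"
  using assms by (auto simp: cell_chains_def)

lemma cell_chains_nonempty_step: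
  "e \<in> cayley_cells G S \<Longrightarrow> x \<in> e \<Longrightarrow> y \<in> e \<Longrightarrow> cell_chains G S x y \<noteq> {}"
  using chain_step[of e G S x y] by (rule_tac notI) simp

lemma cell_chains_nonempty_sym:
  assumes "cell_chains G S x y \<noteq> {}"
  shows "cell_chains G S y x \<noteq> {}"
proof -
  from assms obtain c where "c \<in> cell_chains G S x y" unfolding ex_in_conv[symmetric] ..
  then show ?thesis by (cases c) (auto dest: cell_chains_rev(1))
qed

lemma cell_chains_nonempty_trans:
  assumes "cell_chains G S x y \<noteq> {}" "cell_chains G S y z \<noteq> {}"
  shows "cell_chains G S x z \<noteq> {}"
proof -
  from assms(1) obtain c where "c \<in> cell_chains G S x y" unfolding ex_in_conv[symmetric] ..
  moreover from assms(2) obtain c' where "c' \<in> cell_chains G S y z" unfolding ex_in_conv[symmetric] ..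
  ultimately show ?thesis by (cases c; cases c') (auto dest: cell_chains_append(1))
qed

lemma segment_ends: "indicator {u} \<in> segment u v" "indicator {v} \<in> segment u v"
  unfolding segment_def by (rule CollectI, rule exI[of _ 0], simp) (rule CollectI, rule exI[of _ 1], simp)

lemma chain_vertices:
  assumes "group G" "S \<subseteq> carrier G" "h \<in> generate G S" "g \<in> carrier G"
  shows "cell_chains G S (indicator {g}) (indicator {g \<otimes>\<^bsub>G\<^esub> h}) \<noteq> {}"
  using assms(3,4)
proof (induction arbitrary: g rule: generate.induct)
  interpret group G by fact
  have edge: "cell_chains G S (indicator {g}) (indicator {g \<otimes>\<^bsub>G\<^esub> h}) \<noteq> {}"
    if "g \<in> carrier G" "h \<in> S" for g h
  proof (rule cell_chains_nonempty_step[OF _ segment_ends])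
    show "segment g (g \<otimes>\<^bsub>G\<^esub> h) \<in> cayley_cells G S"
      unfolding cayley_cells_def
      by (intro UnI2 CollectI exI[of _ g] exI[of _ h] conjI refl that)
  qed
  {
    case one
    then have "segment g g \<in> cayley_cells G S" by (auto simp: cayley_cells_def)
    then show ?case using one by (simp add: cell_chains_nonempty_step[OF _ segment_ends])
  next
    case (incl h)
    then show ?case by (intro edge)
  next
    case (inv h)
    then have h: "h \<in> carrier G" using assms(2) by auto
    then have "cell_chains G S (indicator {g \<otimes>\<^bsub>G\<^esub> inv\<^bsub>G\<^esub> h}) (indicator {g \<otimes>\<^bsub>G\<^esub> inv\<^bsub>G\<^esub> h \<otimes>\<^bsub>G\<^esub> h}) \<noteq> {}"
      using inv by (intro edge) auto
    moreover have "g \<otimes>\<^bsub>G\<^esub> inv\<^bsub>G\<^esub> h \<otimes>\<^bsub>G\<^esub> h = g" using inv h by (simp add: m_assoc)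
    ultimately have "cell_chains G S (indicator {g \<otimes>\<^bsub>G\<^esub> inv\<^bsub>G\<^esub> h}) (indicator {g}) \<noteq> {}" by simp
    then show ?case by (rule cell_chains_nonempty_sym)
  next
    case (eng h1 h2)
    have h: "h1 \<in> carrier G" "h2 \<in> carrier G"
      using eng(1,2) generate_in_carrier[OF assms(2)] by auto
    have "cell_chains G S (indicator {g}) (indicator {g \<otimes>\<^bsub>G\<^esub> h1 \<otimes>\<^bsub>G\<^esub> h2}) \<noteq> {}"
      using eng(3)[OF eng(5)] eng(4)[OF m_closed[OF eng(5) h(1)]] by (rule cell_chains_nonempty_trans)
    then show ?case unfolding m_assoc[OF eng(5) h] .
  }
qed

lemma cell_chains_nonempty:
  assumes "group G" "finite_generating_set G S" "x \<in> cayley_space G S" "y \<in> cayley_space G S"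
  shows "cell_chains G S x y \<noteq> {}"
proof -
  interpret group G by fact
  have S: "S \<subseteq> carrier G" "generate G S = carrier G"
    using assms(2) by (auto simp: finite_generating_set_def)
  have base: "\<exists>g \<in> carrier G. cell_chains G S x (indicator {g}) \<noteq> {}" if "x \<in> cayley_space G S" for x
  proof -
    from that obtain e where e: "e \<in> cayley_cells G S" "x \<in> e" by (auto simp: cayley_space_def)
    then obtain g v where g: "g \<in> carrier G" "e = segment g v" by (auto simp: cayley_cells_def)
    then have "indicator {g} \<in> e" by (simp add: segment_ends)
    from cell_chains_nonempty_step[OF e this] show ?thesis using g(1) by (rule bexI)
  qed
  obtain g where g: "g \<in> carrier G" "cell_chains G S x (indicator {g}) \<noteq> {}"
    using base[OF assms(3)] by (rule bexE)
  obtain h where h: "h \<in> carrier G" "cell_chains G S y (indicator {h}) \<noteq> {}"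
    using base[OF assms(4)] by (rule bexE)
  have "cell_chains G S (indicator {g}) (indicator {g \<otimes>\<^bsub>G\<^esub> (inv\<^bsub>G\<^esub> g \<otimes>\<^bsub>G\<^esub> h)}) \<noteq> {}"
    by (rule chain_vertices[OF assms(1) S(1) _ g(1)]) (simp add: S(2) g(1) h(1))
  moreover have "g \<otimes>\<^bsub>G\<^esub> (inv\<^bsub>G\<^esub> g \<otimes>\<^bsub>G\<^esub> h) = h"
    using m_assoc[OF g(1) inv_closed[OF g(1)] h(1)] g(1) h(1) by simp
  ultimately have "cell_chains G S (indicator {g}) (indicator {h}) \<noteq> {}" by simp
  from cell_chains_nonempty_trans[OF cell_chains_nonempty_trans[OF g(2) this] cell_chains_nonempty_sym[OF h(2)]]
  show ?thesis .
qed

lemma Metric_space_cayley: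
  assumes "group G" "finite_generating_set G S"
  shows "Metric_space (cayley_space G S) (cayley_dist G S)"
proof
  have chain_small: "\<exists>k p. (k, p) \<in> cell_chains G S x y \<and>
      (\<Sum>i<k. cell_dist (p i) (p (Suc i))) < cayley_dist G S x y + e"
    if "x \<in> cayley_space G S" "y \<in> cayley_space G S" "e > 0" for x y e
  proof -
    have "\<exists>c \<in> cell_chains G S x y. (case c of (k, p) \<Rightarrow> \<Sum>i<k. cell_dist (p i) (p (Suc i)))
        < cayley_dist G S x y + e"
      using that cell_chains_nonempty[OF assms that(1,2)]
      by (subst cINF_less_iff[symmetric])
        (auto simp: cayley_dist_def intro!: bdd_belowI2[where m = 0] chain_nonneg)
    then show ?thesis by auto
  qed
  show comm: "cayley_dist G S x y = cayley_dist G S y x" for x y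
  proof -
    have "(\<lambda>(k, p). \<Sum>i<k. cell_dist (p i) (p (Suc i))) ` cell_chains G S x y
        \<subseteq> (\<lambda>(k, p). \<Sum>i<k. cell_dist (p i) (p (Suc i))) ` cell_chains G S y x" for x y
    proof clarify
      fix k p assume "(k, p) \<in> cell_chains G S x y"
      from cell_chains_rev[OF this]
      show "(\<Sum>i<k. cell_dist (p i) (p (Suc i)))
          \<in> (\<lambda>(k, p). \<Sum>i<k. cell_dist (p i) (p (Suc i))) ` cell_chains G S y x"
        by (intro image_eqI[where x = "(k, \<lambda>i. p (k - i))"]) auto
    qed
    then show ?thesis unfolding cayley_dist_def by (metis (no_types, lifting) subset_antisym)
  qed
  show nonneg: "0 \<le> cayley_dist G S x y" for x y
  proof (cases "x \<in> cayley_space G S \<and> y \<in> cayley_space G S")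
    case True
    then have "cell_chains G S x y \<noteq> {}" by (intro cell_chains_nonempty[OF assms]) auto
    then have "0 \<le> (INF (k, p) \<in> cell_chains G S x y. \<Sum>i<k. cell_dist (p i) (p (Suc i)))"
      by (intro cINF_greatest) (auto intro: chain_nonneg)
    with True show ?thesis by (simp add: cayley_dist_def)
  qed (auto simp: cayley_dist_def)
  show "(cayley_dist G S x y = 0) = (x = y)"
    if xy: "x \<in> cayley_space G S" "y \<in> cayley_space G S" for x y
  proof
    assume 0: "cayley_dist G S x y = 0"
    have "\<bar>x w - y w\<bar> \<le> 0" for w
    proof (rule field_le_epsilon)
      fix e :: real assume "e > 0"
      then obtain k p where p: "(k, p) \<in> cell_chains G S x y"
        "(\<Sum>i<k. cell_dist (p i) (p (Suc i))) < cayley_dist G S x y + e"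
        using chain_small[OF xy] by blast
      with chain_ge[OF p(1), of w] 0 show "\<bar>x w - y w\<bar> \<le> 0 + e" by simp
    qed
    then show "x = y" by (intro ext) simp
  next
    assume "x = y"
    have "(0, \<lambda>_. x) \<in> cell_chains G S x y" using \<open>x = y\<close> by (simp add: cell_chains_def)
    from cayley_dist_le[OF this xy] nonneg[of x y]
    show "cayley_dist G S x y = 0" by simp
  qed
  show "cayley_dist G S x z \<le> cayley_dist G S x y + cayley_dist G S y z"
    if x: "x \<in> cayley_space G S" and y: "y \<in> cayley_space G S" and z: "z \<in> cayley_space G S" for x y z
  proof (rule field_le_epsilon)
    fix e :: real assume "e > 0"
    then have "e / 2 > 0" by simp
    obtain k p where 1: "(k, p) \<in> cell_chains G S x y"
      "(\<Sum>i<k. cell_dist (p i) (p (Suc i))) < cayley_dist G S x y + e / 2"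
      using chain_small[OF x y \<open>e / 2 > 0\<close>] by auto
    obtain l q where 2: "(l, q) \<in> cell_chains G S y z"
      "(\<Sum>i<l. cell_dist (q i) (q (Suc i))) < cayley_dist G S y z + e / 2"
      using chain_small[OF y z \<open>e / 2 > 0\<close>] by auto
    from cayley_dist_le[OF cell_chains_append(1)[OF 1(1) 2(1)] x z] cell_chains_append(2)[OF 1(1) 2(1)] 1 2
    show "cayley_dist G S x z \<le> cayley_dist G S x y + cayley_dist G S y z + e" by linarith
  qed
qed


section \<open>Finitely presented groups\<close>

text \<open>The letter \<open>(True, x)\<close> stands for the generator \<open>x\<close> and \<open>(False, x)\<close> for its inverse. Elements
  of the free group are reduced words.\<close>

type_synonym 'x letter = "bool \<times> 'x"

definition letter_inv :: "'x letter \<Rightarrow> 'x letter" where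
  "letter_inv l = (\<not> fst l, snd l)"

definition reduced_word :: "'x letter list \<Rightarrow> bool" where
  "reduced_word = successively (\<lambda>l m. m \<noteq> letter_inv l)"

fun push :: "'x letter \<Rightarrow> 'x letter list \<Rightarrow> 'x letter list" where
  "push l [] = [l]"
| "push l (m # w) = (if m = letter_inv l then w else l # m # w)"

definition free_group :: "'x set \<Rightarrow> 'x letter list monoid" where
  "free_group X = \<lparr>carrier = {w \<in> lists (UNIV \<times> X). reduced_word w},
                   monoid.mult = (\<lambda>u v. foldr push u v), one = []\<rparr>"

lemma letter_inv_inv [simp]: "letter_inv (letter_inv l) = l"
  by (simp add: letter_inv_def)

lemma letter_inv_neq [simp]: "letter_inv l \<noteq> l" "l \<noteq> letter_inv l"
  by (cases l; simp add: letter_inv_def)+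

lemma reduced_push: "reduced_word w \<Longrightarrow> reduced_word (push l w)"
  by (cases w rule: list.exhaust) (auto simp: reduced_word_def successively_Cons)

lemma push_push: "reduced_word w \<Longrightarrow> push l (push (letter_inv l) w) = w"
  by (cases w rule: remdups_adj.cases) (auto simp: reduced_word_def)

lemma reduced_foldr: "reduced_word w \<Longrightarrow> reduced_word (foldr push u w)"
  by (induction u) (auto intro: reduced_push)

lemma foldr_push_push:
  assumes "reduced_word w"
  shows "foldr push (push l v) w = push l (foldr push v w)"
proof (cases v)
  case (Cons m v')
  then show ?thesis using push_push[OF reduced_foldr[OF assms], of l v'] by auto
qed simp

lemma foldr_push_assoc:
  assumes "reduced_word w"
  shows "foldr push (foldr push u v) w = foldr push u (foldr push v w)"
  using assms by (induction u) (auto simp: foldr_push_push)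

lemma foldr_push_Nil: "reduced_word w \<Longrightarrow> foldr push w [] = w"
proof (induction w)
  case (Cons l w)
  then show ?case by (cases w) (auto simp: reduced_word_def)
qed simp

lemma foldr_push_lists:
  "u \<in> lists (UNIV \<times> X) \<Longrightarrow> w \<in> lists (UNIV \<times> X) \<Longrightarrow> foldr push u w \<in> lists (UNIV \<times> X)"
proof (induction u)
  case (Cons l u)
  then show ?case by (cases "foldr push u w") auto
qed simp

lemma foldr_push_inverse:
  "foldr push (map letter_inv (rev u)) u = []"
proof -
  have "foldr push (map letter_inv (rev u)) (u @ v) = v" for v
    by (induction u arbitrary: v) auto
  from this[of "[]"] show ?thesis by simp
qed

lemma reduced_inverse: "reduced_word u \<Longrightarrow> reduced_word (map letter_inv (rev u))"
  unfolding reduced_word_def successively_map successively_rev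
  by (erule successively_mono) auto

lemma group_free_group: "group (free_group X)"
proof (rule groupI)
  fix u assume u: "u \<in> carrier (free_group X)"
  show "\<exists>v \<in> carrier (free_group X). v \<otimes>\<^bsub>free_group X\<^esub> u = \<one>\<^bsub>free_group X\<^esub>"
    using u foldr_push_inverse[of u] reduced_inverse[of u]
    by (intro bexI[of _ "map letter_inv (rev u)"]) (force simp: free_group_def letter_inv_def)+
next
  fix u v assume "u \<in> carrier (free_group X)" "v \<in> carrier (free_group X)"
  then show "u \<otimes>\<^bsub>free_group X\<^esub> v \<in> carrier (free_group X)"
    unfolding free_group_def by (simp del: in_lists_conv_set add: foldr_push_lists reduced_foldr)
qed (auto simp: free_group_def foldr_push_assoc reduced_word_def)

definition normal_closure :: "('a, 'b) monoid_scheme \<Rightarrow> 'a set \<Rightarrow> 'a set" where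
  "normal_closure F R = generate F {g \<otimes>\<^bsub>F\<^esub> r \<otimes>\<^bsub>F\<^esub> inv\<^bsub>F\<^esub> g | g r. g \<in> carrier F \<and> r \<in> R}"

definition finitely_presented :: "('a, 'b) monoid_scheme \<Rightarrow> bool" where
  "finitely_presented G \<longleftrightarrow> (\<exists>(k::nat) R. finite R \<and> R \<subseteq> carrier (free_group {..<k}) \<and>
     G \<cong> free_group {..<k} Mod normal_closure (free_group {..<k}) R)"


lemma normal_normal_closure:
  assumes "group F" "R \<subseteq> carrier F"
  shows "normal_closure F R \<lhd> F"
proof -
  interpret group F by fact
  show ?thesis
    unfolding normal_closure_def
  proof (rule normal_generateI)
    fix h g assume "h \<in> {g \<otimes>\<^bsub>F\<^esub> r \<otimes>\<^bsub>F\<^esub> inv\<^bsub>F\<^esub> g | g r. g \<in> carrier F \<and> r \<in> R}" and g: "g \<in> carrier F"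
    then obtain k r where k: "h = k \<otimes>\<^bsub>F\<^esub> r \<otimes>\<^bsub>F\<^esub> inv\<^bsub>F\<^esub> k" "k \<in> carrier F" "r \<in> R" by blast
    moreover from this have "r \<in> carrier F" using assms(2) by auto
    ultimately have "g \<otimes>\<^bsub>F\<^esub> h \<otimes>\<^bsub>F\<^esub> inv\<^bsub>F\<^esub> g = (g \<otimes>\<^bsub>F\<^esub> k) \<otimes>\<^bsub>F\<^esub> r \<otimes>\<^bsub>F\<^esub> inv\<^bsub>F\<^esub> (g \<otimes>\<^bsub>F\<^esub> k)"
      using g by (simp add: m_assoc inv_mult_group)
    with g k show "g \<otimes>\<^bsub>F\<^esub> h \<otimes>\<^bsub>F\<^esub> inv\<^bsub>F\<^esub> g \<in> {g \<otimes>\<^bsub>F\<^esub> r \<otimes>\<^bsub>F\<^esub> inv\<^bsub>F\<^esub> g | g r. g \<in> carrier F \<and> r \<in> R}"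
      by blast
  qed (use assms in auto)
qed


section \<open>Ends and divergence of a group\<close>

definition one_ended_group :: "('a, 'b) monoid_scheme \<Rightarrow> bool" where
  "one_ended_group G \<longleftrightarrow> (\<exists>S. finite_generating_set G S \<and>
     Metric_space.one_ended (cayley_space G S) (cayley_dist G S))"

definition cayley_Div :: "('a, 'b) monoid_scheme \<Rightarrow> 'a set \<Rightarrow> real \<Rightarrow> real \<Rightarrow> real \<Rightarrow> ennreal" where
  "cayley_Div G S = Metric_space.Div (cayley_space G S) (cayley_dist G S)"

text \<open>The constants \<open>\<delta>\<^sub>0\<close>, \<open>\<gamma>\<^sub>0\<close> defining the divergence of a group are characterized by this stability
  property; here it is only required of the Cayley graphs of the group \<open>G\<close> itself.\<close>

definition divergence_constants :: "('a, 'b) monoid_scheme \<Rightarrow> real \<Rightarrow> real \<Rightarrow> bool" where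
  "divergence_constants G \<delta>\<^sub>0 \<gamma>\<^sub>0 \<longleftrightarrow> 0 < \<delta>\<^sub>0 \<and> \<delta>\<^sub>0 < 1 \<and> 0 \<le> \<gamma>\<^sub>0 \<and>
     (\<forall>S \<delta> \<gamma>. finite_generating_set G S \<and> 0 < \<delta> \<and> \<delta> \<le> \<delta>\<^sub>0 \<and> \<gamma>\<^sub>0 \<le> \<gamma> \<longrightarrow>
        cayley_Div G S \<gamma> \<delta> \<asymp> cayley_Div G S \<gamma>\<^sub>0 \<delta>\<^sub>0)"

end

theory Submission
  imports Defs
begin

text \<open>Let \<open>a\<close>, \<open>b\<close>, \<open>c\<close> be points of the Cayley graph, with \<open>r\<close> the distance from \<open>c\<close> to \<open>{a, b}\<close> and \<open>a\<close>, \<open>b\<close> at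
  distance at most \<open>n\<close>. By the stability of the divergence under changes of its two parameters, \<open>\<delta>\<close> may be
  taken as small and \<open>\<gamma>\<close> as large as desired. If \<open>\<delta>r \<le> \<gamma>\<close>, nothing has to be avoided, and if \<open>r\<close> is at least \<open>2n\<close>, a
  geodesic from \<open>a\<close> to \<open>b\<close> has no time to come near \<open>c\<close>; in both cases a path of length about \<open>n\<close> will do. What remains is \<open>r < 2n\<close>, where all three points lie in a
  ball of radius linear in \<open>n\<close>. A finitely generated group has at most exponentially many elements in such a
  ball, and a connected set of vertices is crossed by a walk whose length is bounded by its number of
  edges (\<open>short_walk\<close>). So it is enough to join \<open>a\<close> and \<open>b\<close> by some walk that avoids a
  ball of radius about \<open>\<delta>r\<close> around \<open>c\<close> and does not stray further than linearly far away; its existence is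
  \<open>annulus_walk\<close>, and this is where the two hypotheses on the group enter.

  One end. Let \<open>\<rho>\<close> be about \<open>\<delta>r\<close>, and let \<open>U\<close> be the component of \<open>a\<close> in the complement of the ball of radius
  \<open>\<rho>\<close> around \<open>c\<close>. Since \<open>U\<close> has finite boundary and the group has one end, \<open>U\<close> is finite or cofinite
  (\<open>outer_comp_finite_or_cofinite\<close>). It cannot be finite when \<open>a\<close> is more than \<open>2\<rho>\<close> away from \<open>c\<close>: translating \<open>c\<close> to \<open>a\<close> would
  turn \<open>U\<close> into a proper subset of itself (\<open>deep_outer_comp_infinite\<close>). The same holds for \<open>b\<close>, and
  two cofinite components of an infinite group meet, so that \<open>a\<close> and \<open>b\<close> lie in the same \<open>U\<close>. One-endedness
  is assumed for some Cayley graph only; it is transferred through the purely group-theoretic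
  \<open>one_end_property\<close>, which speaks of almost invariant subsets and mentions no generators.

  Finite presentation. Descending along geodesics towards \<open>c\<close>, both \<open>a\<close> and \<open>b\<close> reach the boundary of \<open>U\<close>
  inside \<open>U\<close>. A finite presentation makes the Cayley graph simply connected once all loops of a
  certain bounded length are filled. The only consequence that matters is cohomological
  (\<open>finitely_presented_imp_H1_trivial\<close>): a function modulo 2 on pairs of vertices that satisfies the cocycle
  identity on all triangles of bounded diameter is a coboundary on the edges. If the boundary of \<open>U\<close> split into
  two parts far from each other, then counting the crossings through one of the two parts would be
  such a cocycle, and since both \<open>U\<close> and its complement are connected it could not be a coboundary
  (\<open>boundary_linked\<close>). So the boundary of \<open>U\<close> is coarsely connected, and moving along it leads from \<open>a\<close> to
  \<open>b\<close> at bounded distance from the sphere of radius \<open>\<rho>\<close>.\<close>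

section \<open>The word metric\<close>

locale cayley_graph = group G for G (structure) +
  fixes S :: "'a set"
  assumes fin_gen: "finite_generating_set G S"
begin

text \<open>Paths may run through the edges of the Cayley graph in both directions, so inverses of generators are
  steps as well.\<close>

definition gens :: "'a set" where "gens = S \<union> m_inv G ` S"

definition edges :: "('a \<times> 'a) set" where "edges = {(u, u \<otimes> t) | u t. u \<in> carrier G \<and> t \<in> gens}"

definition gdist :: "'a \<Rightarrow> 'a \<Rightarrow> nat" where "gdist u v = (LEAST n. (u, v) \<in> edges ^^ n)"

lemma S_subset: "S \<subseteq> carrier G" and S_generates: "generate G S = carrier G"
  and finite_S: "finite S"
  using fin_gen by (auto simp: finite_generating_set_def)

lemma gens_subset: "gens \<subseteq> carrier G"
  using S_subset by (auto simp: gens_def)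

lemma finite_gens: "finite gens"
  using finite_S by (simp add: gens_def)

lemma gens_inv: "t \<in> gens \<Longrightarrow> inv t \<in> gens"
  using S_subset by (auto simp: gens_def)

lemma edges_carrier: "(u, v) \<in> edges \<Longrightarrow> u \<in> carrier G \<and> v \<in> carrier G"
  using gens_subset by (auto simp: edges_def)

lemma edges_sym: "(u, v) \<in> edges \<Longrightarrow> (v, u) \<in> edges"
proof -
  assume "(u, v) \<in> edges"
  then obtain t where t: "u \<in> carrier G" "t \<in> gens" "v = u \<otimes> t"
    by (auto simp: edges_def)
  then have "v \<otimes> inv t = u" "v \<in> carrier G"
    using gens_subset by (auto simp: m_assoc)
  then show ?thesis
    using gens_inv[OF t(2)] by (force simp: edges_def)
qed

lemma sym_edges: "sym edges"
  by (rule symI) (rule edges_sym)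

lemma edges_translate: "g \<in> carrier G \<Longrightarrow> (u, v) \<in> edges \<Longrightarrow> (g \<otimes> u, g \<otimes> v) \<in> edges"
  using gens_subset unfolding edges_def by (force simp: m_assoc)

lemma edges_pow_translate: "g \<in> carrier G \<Longrightarrow> (u, v) \<in> edges ^^ n \<Longrightarrow> (g \<otimes> u, g \<otimes> v) \<in> edges ^^ n"
  by (induction n arbitrary: v) (auto intro: edges_translate)

lemma edges_pow_sym: "(u, v) \<in> edges ^^ n \<Longrightarrow> (v, u) \<in> edges ^^ n"
proof (induction n arbitrary: v)
  case (Suc n)
  then obtain w where "(u, w) \<in> edges ^^ n" "(w, v) \<in> edges" by auto
  then show ?case using Suc.IH edges_sym relpow_Suc_I2 by metis
qed auto

lemma generate_reach:
  assumes "h \<in> generate G S" "g \<in> carrier G"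
  shows "(g, g \<otimes> h) \<in> edges\<^sup>*"
  using assms
proof (induction arbitrary: g rule: generate.induct)
  case (incl h)
  then show ?case by (auto simp: edges_def gens_def intro!: r_into_rtrancl)
next
  case (inv h)
  then show ?case by (auto simp: edges_def gens_def intro!: r_into_rtrancl)
next
  case (eng h1 h2)
  have c: "h1 \<in> carrier G" "h2 \<in> carrier G"
    using eng(1,2) generate_in_carrier[OF S_subset] by auto
  have "(g \<otimes> h1, g \<otimes> h1 \<otimes> h2) \<in> edges\<^sup>*" using eng c by auto
  with eng c show ?case by (metis m_assoc rtrancl_trans)
qed simp

lemma reach:
  assumes "u \<in> carrier G" "v \<in> carrier G"
  shows "(u, v) \<in> edges\<^sup>*"
proof -
  have "(u, u \<otimes> (inv u \<otimes> v)) \<in> edges\<^sup>*"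
    using assms by (intro generate_reach) (auto simp: S_generates)
  then show ?thesis using assms by (simp add: m_assoc[symmetric])
qed

lemma gdist_pow:
  assumes "u \<in> carrier G" "v \<in> carrier G"
  shows "(u, v) \<in> edges ^^ gdist u v"
proof -
  obtain n where "(u, v) \<in> edges ^^ n" using reach[OF assms] rtrancl_imp_relpow by metis
  then show ?thesis unfolding gdist_def by (rule LeastI)
qed

lemma gdist_le: "(u, v) \<in> edges ^^ n \<Longrightarrow> gdist u v \<le> n"
  unfolding gdist_def by (rule Least_le)

lemma gdist_refl [simp]: "gdist u u = 0"
  using gdist_le[of u u 0] by simp

lemma gdist_edge: "(u, v) \<in> edges \<Longrightarrow> gdist u v \<le> 1"
  using gdist_le[of u v 1] by simp

lemma gdist_0_iff: "u \<in> carrier G \<Longrightarrow> v \<in> carrier G \<Longrightarrow> gdist u v = 0 \<longleftrightarrow> u = v"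
  using gdist_pow[of u v] by auto

lemma gdist_sym:
  assumes "u \<in> carrier G" "v \<in> carrier G"
  shows "gdist u v = gdist v u"
  by (meson assms gdist_le gdist_pow edges_pow_sym order_antisym)

lemma gdist_triangle:
  assumes "u \<in> carrier G" "v \<in> carrier G" "w \<in> carrier G"
  shows "gdist u w \<le> gdist u v + gdist v w"
  by (rule gdist_le) (use gdist_pow assms in \<open>auto simp: relpow_add\<close>)

lemma gdist_translate_le:
  assumes "g \<in> carrier G" "u \<in> carrier G" "v \<in> carrier G"
  shows "gdist (g \<otimes> u) (g \<otimes> v) \<le> gdist u v"
  by (intro gdist_le edges_pow_translate gdist_pow assms)

lemma gdist_translate:
  assumes "g \<in> carrier G" "u \<in> carrier G" "v \<in> carrier G"
  shows "gdist (g \<otimes> u) (g \<otimes> v) = gdist u v"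
proof (rule antisym[OF gdist_translate_le[OF assms]])
  have "gdist (inv g \<otimes> (g \<otimes> u)) (inv g \<otimes> (g \<otimes> v)) \<le> gdist (g \<otimes> u) (g \<otimes> v)"
    using assms by (intro gdist_translate_le) auto
  then show "gdist u v \<le> gdist (g \<otimes> u) (g \<otimes> v)"
    using assms by (simp add: m_assoc[symmetric])
qed

text \<open>The last step of a geodesic: moving to such a neighbour brings one a unit closer to \<open>c\<close>. Inductions
  on the distance from \<open>c\<close> run along these steps.\<close>

lemma gdist_parent:
  assumes "c \<in> carrier G" "x \<in> carrier G" "gdist c x = Suc m"
  obtains x' where "(x', x) \<in> edges" "gdist c x' = m"
proof -
  obtain x' where x': "(c, x') \<in> edges ^^ m" "(x', x) \<in> edges"
    using gdist_pow[OF assms(1,2)] assms(3) by auto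
  have "gdist c x \<le> gdist c x' + gdist x' x"
    using x' assms edges_carrier by (intro gdist_triangle) auto
  with gdist_edge[OF x'(2)] gdist_le[OF x'(1)] assms(3) have "gdist c x' = m" by linarith
  with x' that show ?thesis by blast
qed

lemma gdist_edge_le:
  assumes "c \<in> carrier G" "(x, y) \<in> edges"
  shows "gdist c y \<le> gdist c x + 1"
  using gdist_triangle[of c x y] gdist_edge[OF assms(2)] edges_carrier[OF assms(2)] assms(1) by linarith

text \<open>Every point of the next larger ball is a point of the smaller ball times the identity or a
  generator. This is the only source of the exponential in the divergence bound.\<close>

lemma ball_bound:
  assumes "c \<in> carrier G"
  shows "finite {x \<in> carrier G. gdist c x \<le> n} \<and> card {x \<in> carrier G. gdist c x \<le> n} \<le> (card gens + 1) ^ n"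
proof (induction n)
  case 0
  have "{x \<in> carrier G. gdist c x \<le> 0} = {c}" using assms gdist_0_iff by auto
  then show ?case by simp
next
  case (Suc n)
  let ?B = "\<lambda>n. {x \<in> carrier G. gdist c x \<le> n}"
  have sub: "?B (Suc n) \<subseteq> (\<lambda>(x, t). x \<otimes> t) ` (?B n \<times> insert \<one> gens)"
  proof
    fix x assume x: "x \<in> ?B (Suc n)"
    show "x \<in> (\<lambda>(x, t). x \<otimes> t) ` (?B n \<times> insert \<one> gens)"
    proof (cases "gdist c x \<le> n")
      case True
      then show ?thesis using x by (intro image_eqI[where x = "(x, \<one>)"]) auto
    next
      case False
      then have "gdist c x = Suc n" using x by auto
      then obtain x' where x': "(x', x) \<in> edges" "gdist c x' = n"
        using gdist_parent assms x by blast
      then obtain t where "x = x' \<otimes> t" "t \<in> gens" "x' \<in> carrier G" by (auto simp: edges_def)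
      then show ?thesis using x' by (intro image_eqI[where x = "(x', t)"]) auto
    qed
  qed
  have fin: "finite (?B n \<times> insert \<one> gens)" using Suc finite_gens by auto
  have "card (?B (Suc n)) \<le> card (?B n \<times> insert \<one> gens)"
    by (rule order_trans[OF card_mono[OF finite_imageI[OF fin] sub] card_image_le[OF fin]])
  also have "\<dots> = card (?B n) * card (insert \<one> gens)" by (rule card_cartesian_product)
  also have "\<dots> \<le> (card gens + 1) ^ n * (card gens + 1)"
  proof (rule mult_le_mono)
    show "card (?B n) \<le> (card gens + 1) ^ n" using Suc.IH by blast
    show "card (insert \<one> gens) \<le> card gens + 1" using finite_gens by (simp add: card_insert_if)
  qed
  finally show ?case using finite_subset[OF sub finite_imageI[OF fin]] by (simp add: mult.commute)
qed

lemmas finite_ball = ball_bound[THEN conjunct1] and card_ball = ball_bound[THEN conjunct2]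

end

section \<open>Lipschitz paths in the Cayley graph\<close>

context Metric_space
begin

text \<open>Paths parametrized by at most unit speed on an interval whose length bounds their length. Unlike paths
  on the unit interval, they are concatenated without reparametrization.\<close>

definition joined :: "'a set \<Rightarrow> real \<Rightarrow> 'a \<Rightarrow> 'a \<Rightarrow> bool" where
  "joined Y L x y \<longleftrightarrow> 0 \<le> L \<and> (\<exists>p. p 0 = x \<and> p L = y \<and> (\<forall>s\<in>{0..L}. p s \<in> M \<inter> Y) \<and>
     (\<forall>s\<in>{0..L}. \<forall>t\<in>{0..L}. d (p s) (p t) \<le> \<bar>s - t\<bar>))"

lemma joined_refl: "x \<in> M \<Longrightarrow> x \<in> Y \<Longrightarrow> joined Y 0 x x"
  unfolding joined_def by (intro conjI exI[of _ "\<lambda>_. x"]) auto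

lemma joined_sym:
  assumes "joined Y L x y"
  shows "joined Y L y x"
proof -
  obtain p where p: "0 \<le> L" "p 0 = x" "p L = y" "\<And>s. s \<in> {0..L} \<Longrightarrow> p s \<in> M \<inter> Y"
    "\<And>s t. s \<in> {0..L} \<Longrightarrow> t \<in> {0..L} \<Longrightarrow> d (p s) (p t) \<le> \<bar>s - t\<bar>"
    using assms unfolding joined_def by blast
  have "d (p (L - s)) (p (L - t)) \<le> \<bar>s - t\<bar>" if "s \<in> {0..L}" "t \<in> {0..L}" for s t
    using p(5)[of "L - s" "L - t"] that by auto
  moreover have "p (L - s) \<in> M \<inter> Y" if "s \<in> {0..L}" for s
    using p(4)[of "L - s"] that by auto
  ultimately show ?thesis using p(1-3)
    unfolding joined_def by (intro conjI exI[of _ "\<lambda>s. p (L - s)"]) auto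
qed

text \<open>The path may wait at its end.\<close>

lemma joined_mono:
  assumes "joined Y L x y" "L \<le> L'"
  shows "joined Y L' x y"
proof -
  obtain p where p: "0 \<le> L" "p 0 = x" "p L = y" "\<And>s. s \<in> {0..L} \<Longrightarrow> p s \<in> M \<inter> Y"
    "\<And>s t. s \<in> {0..L} \<Longrightarrow> t \<in> {0..L} \<Longrightarrow> d (p s) (p t) \<le> \<bar>s - t\<bar>"
    using assms(1) unfolding joined_def by blast
  have "d (p (min s L)) (p (min t L)) \<le> \<bar>s - t\<bar>" if "s \<in> {0..L'}" "t \<in> {0..L'}" for s t
    using p(5)[of "min s L" "min t L"] p(1) that by (auto simp: min_def split: if_splits)
  moreover have "p (min s L) \<in> M \<inter> Y" if "s \<in> {0..L'}" for s
    using p(1) p(4)[of "min s L"] that by auto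
  ultimately show ?thesis using p(1-3) assms(2)
    unfolding joined_def by (intro conjI exI[of _ "\<lambda>s. p (min s L)"]) auto
qed

lemma joined_trans:
  assumes "joined Y L x y" "joined Y L' y z"
  shows "joined Y (L + L') x z"
proof -
  obtain p where p: "0 \<le> L" "p 0 = x" "p L = y" "\<And>s. s \<in> {0..L} \<Longrightarrow> p s \<in> M \<inter> Y"
    "\<And>s t. s \<in> {0..L} \<Longrightarrow> t \<in> {0..L} \<Longrightarrow> d (p s) (p t) \<le> \<bar>s - t\<bar>"
    using assms(1) unfolding joined_def by blast
  obtain q where q: "0 \<le> L'" "q 0 = y" "q L' = z" "\<And>s. s \<in> {0..L'} \<Longrightarrow> q s \<in> M \<inter> Y"
    "\<And>s t. s \<in> {0..L'} \<Longrightarrow> t \<in> {0..L'} \<Longrightarrow> d (q s) (q t) \<le> \<bar>s - t\<bar>"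
    using assms(2) unfolding joined_def by blast
  define r where "r = (\<lambda>s. if s \<le> L then p s else q (s - L))"
  have r_M: "r s \<in> M \<inter> Y" if "s \<in> {0..L + L'}" for s
    using that p(4) q(4) by (auto simp: r_def)
  have ordered: "d (r s) (r t) \<le> t - s" if "0 \<le> s" "s \<le> t" "t \<le> L + L'" for s t
  proof -
    consider "t \<le> L" | "L < s" | "s \<le> L" "L < t" by linarith
    then show ?thesis
    proof cases
      case 3
      have "d (p s) (q (t - L)) \<le> d (p s) y + d y (q (t - L))"
        using that 3 p(1) p(4)[of s] p(4)[of L] p(3) q(4)[of "t - L"] by (intro triangle) auto
      also have "\<dots> \<le> (L - s) + (t - L)"
        using that 3 p(5)[of s L] p(3) q(5)[of 0 "t - L"] q(2) by auto
      finally show ?thesis using 3 by (simp add: r_def)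
    qed (use that p(5)[of s t] q(5)[of "s - L" "t - L"] in \<open>auto simp: r_def\<close>)
  qed
  have "d (r s) (r t) \<le> \<bar>s - t\<bar>" if "s \<in> {0..L + L'}" "t \<in> {0..L + L'}" for s t
    using ordered[of s t] ordered[of t s] that commute[of "r s" "r t"] by (cases "s \<le> t") auto
  moreover have "r 0 = x" "r (L + L') = z"
    using p(1-3) q(1-3) by (auto simp: r_def)
  ultimately show ?thesis
    using r_M p(1) q(1) unfolding joined_def by (intro conjI exI[of _ r]) auto
qed

text \<open>A path of length \<open>L\<close> stays within distance \<open>L\<close> of its starting point, so short paths avoid whatever is
  far from there.\<close>

lemma joined_near:
  assumes "joined UNIV L x y" "\<And>z. z \<in> M \<Longrightarrow> d x z \<le> L \<Longrightarrow> z \<in> Y"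
  shows "joined Y L x y"
proof -
  obtain p where p: "0 \<le> L" "p 0 = x" "p L = y" "\<And>s. s \<in> {0..L} \<Longrightarrow> p s \<in> M"
    "\<And>s t. s \<in> {0..L} \<Longrightarrow> t \<in> {0..L} \<Longrightarrow> d (p s) (p t) \<le> \<bar>s - t\<bar>"
    using assms(1) unfolding joined_def by blast
  have "p s \<in> Y" if "s \<in> {0..L}" for s
    using p(5)[of 0 s] that p(1,2,4) by (intro assms(2)) auto
  then show ?thesis using p unfolding joined_def by (intro conjI exI[of _ p]) auto
qed

lemma lipschitz_pathin:
  assumes "\<And>s. s \<in> {0..1} \<Longrightarrow> q s \<in> M"
    and "\<And>s t. s \<in> {0..1} \<Longrightarrow> t \<in> {0..1} \<Longrightarrow> d (q s) (q t) \<le> L * \<bar>s - t\<bar>"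
  shows "pathin mtopology q"
proof -
  have "Lipschitz_continuous_map (submetric euclidean_metric {0..1}) (metric (M, d)) q"
    unfolding Lipschitz_continuous_map_def using assms by (auto simp: dist_real_def intro!: exI[of _ L])
  from Lipschitz_continuous_imp_continuous_map[OF this] show ?thesis
    unfolding mtopology_of_submetric mtopology_of_euclidean by (simp add: pathin_def mtopology_of_def)
qed

text \<open>Rescaled to the unit interval the path is \<open>L\<close>-Lipschitz, so its variation is at most \<open>L\<close>.\<close>

lemma div3_le_joined:
  assumes "joined (- mball c (\<delta> * min (d c a) (d c b) - \<gamma>)) L a b"
  shows "div3 \<gamma> a b c \<delta> \<le> ennreal L"
proof -
  obtain p where p: "0 \<le> L" "p 0 = a" "p L = b"
    "\<And>s. s \<in> {0..L} \<Longrightarrow> p s \<in> M \<inter> - mball c (\<delta> * min (d c a) (d c b) - \<gamma>)"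
    "\<And>s t. s \<in> {0..L} \<Longrightarrow> t \<in> {0..L} \<Longrightarrow> d (p s) (p t) \<le> \<bar>s - t\<bar>"
    using assms unfolding joined_def by blast
  define q where "q s = p (L * s)" for s
  have in_I: "L * s \<in> {0..L}" if "s \<in> {0..1}" for s
    using p(1) that mult_left_mono[of s 1 L] by auto
  have lip: "d (q s) (q t) \<le> L * \<bar>s - t\<bar>" if "s \<in> {0..1}" "t \<in> {0..1}" for s t
    using p(5)[OF in_I[OF that(1)] in_I[OF that(2)]] p(1)
    by (simp add: q_def abs_mult right_diff_distrib[symmetric])
  have q_M: "q s \<in> M" "q s \<notin> mball c (\<delta> * min (d c a) (d c b) - \<gamma>)" if "s \<in> {0..1}" for s
    using p(4)[OF in_I[OF that]] by (auto simp: q_def)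
  have "pathin mtopology q" using q_M(1) lip by (rule lipschitz_pathin)
  have "path_length q \<le> ennreal L"
    unfolding path_length_def
  proof (rule SUP_least, clarify)
    fix k :: nat and t :: "nat \<Rightarrow> real"
    assume t: "mono t" "range t \<subseteq> {0..1}"
    have "(\<Sum>i<k. ennreal (d (q (t i)) (q (t (Suc i))))) \<le> (\<Sum>i<k. ennreal (L * (t (Suc i) - t i)))"
    proof (intro sum_mono ennreal_leI)
      fix i
      have "t i \<le> t (Suc i)" using t(1) by (simp add: mono_def)
      moreover have "t i \<in> {0..1}" "t (Suc i) \<in> {0..1}" using t(2) by blast+
      ultimately show "d (q (t i)) (q (t (Suc i))) \<le> L * (t (Suc i) - t i)"
        using lip[of "t i" "t (Suc i)"] by simp
    qed
    also have "\<dots> = ennreal (\<Sum>i<k. L * (t (Suc i) - t i))"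
      using t(1) p(1) by (intro sum_ennreal) (auto simp: mono_def)
    also have "(\<Sum>i<k. L * (t (Suc i) - t i)) = L * (t k - t 0)"
      by (simp add: sum_distrib_left[symmetric] sum_lessThan_telescope)
    also have "ennreal (L * (t k - t 0)) \<le> ennreal L"
    proof (rule ennreal_leI)
      have "t k \<in> {0..1}" "t 0 \<in> {0..1}" using t(2) by blast+
      then have "t k - t 0 \<le> 1" by auto
      then show "L * (t k - t 0) \<le> L" using p(1) mult_left_mono[of "t k - t 0" 1 L] by simp
    qed
    finally show "(\<Sum>i<k. ennreal (d (q (t i)) (q (t (Suc i))))) \<le> ennreal L" .
  qed
  moreover have "q 0 = a" "q 1 = b" using p by (auto simp: q_def)
  ultimately show ?thesis
    unfolding div3_def using q_M \<open>pathin mtopology q\<close> by (intro INF_lower2[of q]) auto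
qed

end

context cayley_graph
begin

sublocale X: Metric_space "cayley_space G S" "cayley_dist G S"
  by (rule Metric_space_cayley[OF group_axioms fin_gen])

definition lin :: "'a \<Rightarrow> 'a \<Rightarrow> real \<Rightarrow> 'a \<Rightarrow> real" where
  "lin u v t = (\<lambda>w. (1 - t) * indicator {u} w + t * indicator {v} w)"

definition vtx :: "'a \<Rightarrow> 'a \<Rightarrow> real" where "vtx u = indicator {u}"

lemma lin_0 [simp]: "lin u v 0 = vtx u" and lin_1 [simp]: "lin u v 1 = vtx v"
  by (auto simp: lin_def vtx_def)

lemma segment_lin: "segment u v = lin u v ` {0..1}"
  by (auto simp: segment_def lin_def)

lemma segment_swap:
  fixes u v :: 'a
  shows "segment u v = segment v u"
proof -
  have "segment u v \<subseteq> segment v u" for u v :: 'a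
  proof
    fix x assume "x \<in> segment u v"
    then obtain t where "t \<in> {0..1}" "x = lin u v t" by (auto simp: segment_lin)
    then have "1 - t \<in> {0..1}" "x = lin v u (1 - t)" by (auto simp: lin_def add.commute)
    then show "x \<in> segment v u" unfolding segment_lin by blast
  qed
  from this[of u v] this[of v u] show ?thesis by (rule equalityI)
qed

lemma edge_cell: "(u, v) \<in> edges \<Longrightarrow> segment u v \<in> cayley_cells G S"
proof -
  assume "(u, v) \<in> edges"
  then obtain t where t: "u \<in> carrier G" "t \<in> gens" "v = u \<otimes> t" by (auto simp: edges_def)
  show ?thesis
  proof (cases "t \<in> S")
    case True
    then show ?thesis using t unfolding cayley_cells_def by blast
  next
    case False
    then obtain s where s: "s \<in> S" "t = inv s" using t by (auto simp: gens_def)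
    then have "u = v \<otimes> s" "v \<in> carrier G" using t S_subset by (auto simp: m_assoc)
    then have "segment v u \<in> cayley_cells G S" using s unfolding cayley_cells_def by blast
    then show ?thesis by (simp add: segment_swap)
  qed
qed

lemma vertex_cell: "u \<in> carrier G \<Longrightarrow> segment u u \<in> cayley_cells G S"
  by (auto simp: cayley_cells_def)

lemma cellE:
  assumes "e \<in> cayley_cells G S"
  obtains u v where "e = segment u v" "u \<in> carrier G" "v \<in> carrier G" "u = v \<or> (u, v) \<in> edges"
  using assms S_subset unfolding cayley_cells_def edges_def gens_def by blast

lemma vtx_in_space: "u \<in> carrier G \<Longrightarrow> vtx u \<in> cayley_space G S"
  unfolding vtx_def by (rule subsetD[OF cell_subset[OF vertex_cell] segment_ends(1)])

lemma dist_cell: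
  assumes "e \<in> cayley_cells G S" "x \<in> e" "y \<in> e"
  shows "cayley_dist G S x y \<le> cell_dist x y"
  using cayley_dist_le[OF chain_step[OF assms]] assms cell_subset by fastforce

lemma cell_dist_lin: "u \<noteq> v \<Longrightarrow> cell_dist (lin u v t) (lin u v t') = \<bar>t - t'\<bar>"
  unfolding lin_def by (rule cell_dist_segment)

lemma lin_same [simp]: "lin u u t = vtx u"
  by (auto simp: lin_def vtx_def algebra_simps)

lemma vtx_segment: "vtx u \<in> segment u v"
  unfolding vtx_def by (rule segment_ends)

lemma dist_lin:
  assumes "segment u v \<in> cayley_cells G S" "t \<in> {0..1}" "t' \<in> {0..1}"
  shows "cayley_dist G S (lin u v t) (lin u v t') \<le> \<bar>t - t'\<bar>"
proof (cases "u = v")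
  case True
  have "vtx u \<in> cayley_space G S"
    using cell_subset[OF assms(1)] vtx_segment[of u v] by (rule subsetD)
  then show ?thesis using True by simp
next
  case False
  have "lin u v t \<in> segment u v" "lin u v t' \<in> segment u v"
    using assms by (auto simp: segment_lin)
  from dist_cell[OF assms(1) this] show ?thesis by (simp add: cell_dist_lin[OF False])
qed

lemma dist_lin_vtx:
  assumes "segment u v \<in> cayley_cells G S" "t \<in> {0..1}"
  shows "X.joined UNIV 1 (lin u v t) (vtx u)"
proof (rule X.joined_mono)
  show "X.joined UNIV t (lin u v t) (vtx u)"
    unfolding X.joined_def
  proof (intro conjI exI[of _ "\<lambda>s. lin u v (t - s)"] ballI)
    fix s assume s: "s \<in> {0..t}"
    then have "lin u v (t - s) \<in> segment u v" using assms by (auto simp: segment_lin)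
    then show "lin u v (t - s) \<in> cayley_space G S \<inter> UNIV" using cell_subset[OF assms(1)] by auto
    fix s' assume s': "s' \<in> {0..t}"
    show "cayley_dist G S (lin u v (t - s)) (lin u v (t - s')) \<le> \<bar>s - s'\<bar>"
      using dist_lin[OF assms(1), of "t - s" "t - s'"] assms s s' by auto
  qed (use assms in auto)
qed (use assms in auto)

lemma near_vertex:
  assumes "x \<in> cayley_space G S"
  obtains u where "u \<in> carrier G" "X.joined UNIV 1 x (vtx u)"
proof -
  from assms obtain e where e: "e \<in> cayley_cells G S" "x \<in> e" by (auto simp: cayley_space_def)
  then obtain u v where "e = segment u v" "u \<in> carrier G" by (auto elim: cellE)
  with e that dist_lin_vtx show ?thesis by (auto simp: segment_lin)
qed

lemma joined_dist:
  assumes "X.joined Y L x y"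
  shows "cayley_dist G S x y \<le> L"
proof -
  obtain p where p: "0 \<le> L" "p 0 = x" "p L = y"
    "\<And>s t. s \<in> {0..L} \<Longrightarrow> t \<in> {0..L} \<Longrightarrow> cayley_dist G S (p s) (p t) \<le> \<bar>s - t\<bar>"
    using assms unfolding X.joined_def by auto
  from p(1-3) p(4)[of 0 L] show ?thesis by simp
qed

lemma joined_edge: "(u, v) \<in> edges \<Longrightarrow> X.joined UNIV 1 (vtx u) (vtx v)"
  using dist_lin_vtx[OF edge_cell[OF edges_sym], of u v 1] by simp

text \<open>The affine extension of a function on the vertices to the geometric realization. The sum is finite
  because a point has at most two nonzero barycentric coordinates.\<close>

definition affine_ext :: "('a \<Rightarrow> real) \<Rightarrow> ('a \<Rightarrow> real) \<Rightarrow> real" where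
  "affine_ext f x = (\<Sum>w | x w \<noteq> 0. x w * f w)"

lemma affine_ext_lin: "affine_ext f (lin u v t) = (1 - t) * f u + t * f v"
proof -
  have "affine_ext f (lin u v t) = (\<Sum>w\<in>{u, v}. lin u v t w * f w)"
    unfolding affine_ext_def by (rule sum.mono_neutral_left) (auto simp: lin_def indicator_def split: if_splits)
  also have "\<dots> = (1 - t) * f u + t * f v"
    by (cases "u = v") (auto simp: lin_def vtx_def algebra_simps)
  finally show ?thesis .
qed

lemma affine_ext_vtx: "affine_ext f (vtx u) = f u"
  using affine_ext_lin[of f u u 0] by simp

text \<open>On an edge the slope of the extension is the difference of the values at the two ends. Summing along
  chains turns bounds on edges into lower bounds for the path metric.\<close>

lemma affine_ext_lipschitz:
  assumes f: "\<And>u v. (u, v) \<in> edges \<Longrightarrow> \<bar>f u - f v\<bar> \<le> 1"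
    and xy: "x \<in> cayley_space G S" "y \<in> cayley_space G S"
  shows "\<bar>affine_ext f x - affine_ext f y\<bar> \<le> cayley_dist G S x y"
proof -
  have step: "\<bar>affine_ext f x - affine_ext f y\<bar> \<le> cell_dist x y"
    if e: "e \<in> cayley_cells G S" "x \<in> e" "y \<in> e" for e x y
  proof -
    from cellE[OF e(1)] obtain u v where uv: "e = segment u v" "u = v \<or> (u, v) \<in> edges" by metis
    then obtain t t' where t: "x = lin u v t" "y = lin u v t'"
      using e(2,3) unfolding uv(1) segment_lin by (elim imageE)
    show ?thesis
    proof (cases "u = v")
      case True
      have "0 \<le> cell_dist x y"
        using cell_dist_ge[of x G S y u] e cell_subset[OF e(1)] by force
      then show ?thesis using t True by simp
    next
      case False
      then have "\<bar>f u - f v\<bar> \<le> 1" using f uv by blast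
      have "affine_ext f x - affine_ext f y = (t' - t) * (f u - f v)"
        by (simp add: t affine_ext_lin algebra_simps)
      then have "\<bar>affine_ext f x - affine_ext f y\<bar> = \<bar>t - t'\<bar> * \<bar>f u - f v\<bar>"
        by (simp add: abs_mult abs_minus_commute)
      also have "\<dots> \<le> \<bar>t - t'\<bar>" using \<open>\<bar>f u - f v\<bar> \<le> 1\<close> by (simp add: mult_left_le)
      finally show ?thesis using cell_dist_lin[OF False] t by simp
    qed
  qed
  have "\<bar>affine_ext f x - affine_ext f y\<bar> \<le> (\<Sum>i<k. cell_dist (p i) (p (Suc i)))"
    if kp: "(k, p) \<in> cell_chains G S x y" for k p
  proof -
    have "\<bar>affine_ext f (p 0) - affine_ext f (p m)\<bar> \<le> (\<Sum>i<m. cell_dist (p i) (p (Suc i)))" if "m \<le> k" for m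
      using that
    proof (induction m)
      case (Suc m)
      then obtain e where "e \<in> cayley_cells G S" "p m \<in> e" "p (Suc m) \<in> e"
        using kp by (auto simp: cell_chains_def Suc_le_eq)
      from step[OF this] Suc show ?case by simp
    qed simp
    from this[of k] kp show ?thesis by (auto simp: cell_chains_def)
  qed
  then show ?thesis
    using xy cell_chains_nonempty[OF group_axioms fin_gen xy]
    unfolding cayley_dist_def by (auto intro!: cINF_greatest)
qed

text \<open>Edge walks give one inequality. For the other one, the distance from \<open>u\<close> changes by at most 1 along
  an edge, so its affine extension is a 1-Lipschitz function separating the two vertices.\<close>

lemma dist_vtx:
  assumes "u \<in> carrier G" "v \<in> carrier G"
  shows "cayley_dist G S (vtx u) (vtx v) = real (gdist u v)"
proof (rule antisym)
  have "cayley_dist G S (vtx u) (vtx v) \<le> real n" if "(u, v) \<in> edges ^^ n" for n v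
    using that
  proof (induction n arbitrary: v)
    case 0
    then show ?case using vtx_in_space[OF assms(1)] by simp
  next
    case (Suc n)
    then obtain w where w: "(u, w) \<in> edges ^^ n" "(w, v) \<in> edges" by auto
    have "cayley_dist G S (vtx u) (vtx v) \<le> cayley_dist G S (vtx u) (vtx w) + cayley_dist G S (vtx w) (vtx v)"
      using w edges_carrier assms by (intro X.triangle vtx_in_space) auto
    with Suc.IH[OF w(1)] joined_dist[OF joined_edge[OF w(2)]] show ?case by simp
  qed
  then show "cayley_dist G S (vtx u) (vtx v) \<le> real (gdist u v)" using gdist_pow[OF assms] by blast
  have "\<bar>real (gdist u x) - real (gdist u y)\<bar> \<le> 1" if "(x, y) \<in> edges" for x y
    using gdist_edge_le[OF assms(1) that] gdist_edge_le[OF assms(1) edges_sym[OF that]] by linarith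
  from affine_ext_lipschitz[of "\<lambda>x. real (gdist u x)", OF this vtx_in_space[OF assms(1)] vtx_in_space[OF assms(2)]]
  show "real (gdist u v) \<le> cayley_dist G S (vtx u) (vtx v)" by (simp add: affine_ext_vtx)
qed

lemma joined_walk:
  assumes "(u, v) \<in> R ^^ k" "R \<subseteq> edges" "u \<in> carrier G" "vtx u \<in> Y"
    and "\<And>x y z. (x, y) \<in> R \<Longrightarrow> z \<in> cayley_space G S \<Longrightarrow> cayley_dist G S (vtx x) z \<le> 1 \<Longrightarrow> z \<in> Y"
  shows "X.joined Y (real k) (vtx u) (vtx v)"
  using assms(1)
proof (induction k arbitrary: v)
  case 0
  then show ?case using X.joined_refl[OF vtx_in_space[OF assms(3)] assms(4)] by simp
next
  case (Suc k)
  then obtain w where w: "(u, w) \<in> R ^^ k" "(w, v) \<in> R" by auto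
  have "X.joined Y 1 (vtx w) (vtx v)"
    using w(2) assms(2) by (intro X.joined_near[OF joined_edge]) (auto intro: assms(5))
  from X.joined_trans[OF Suc.IH[OF w(1)] this] show ?case by (simp add: add.commute)
qed

end

section \<open>Ends of the group\<close>

text \<open>Subsets that differ from each of their right translates by finitely many elements are called almost
  invariant; a finitely generated group has at most one end iff only the finite and the cofinite ones are.
  It is enough to ask for finiteness of the elements that leave \<open>A\<close>: those that enter \<open>A\<close> under \<open>g\<close> are
  the translates of those that leave it under the inverse of \<open>g\<close>.\<close>

definition one_end_property :: "('a, 'b) monoid_scheme \<Rightarrow> bool" where
  "one_end_property G \<longleftrightarrow> (\<forall>A\<subseteq>carrier G. (\<forall>g\<in>carrier G. finite {x \<in> A. x \<otimes>\<^bsub>G\<^esub> g \<notin> A}) \<longrightarrow>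
     finite A \<or> finite (carrier G - A))"

context cayley_graph
begin

lemma pointE:
  assumes "x \<in> cayley_space G S"
  obtains u v t where "x = lin u v t" "t \<in> {0..1}" "u \<in> carrier G" "v \<in> carrier G"
    "u = v \<or> (u, v) \<in> edges"
proof -
  from assms obtain e where e: "e \<in> cayley_cells G S" "x \<in> e" by (auto simp: cayley_space_def)
  from cellE[OF e(1)] obtain u v where uv: "e = segment u v" "u \<in> carrier G" "v \<in> carrier G" "u = v \<or> (u, v) \<in> edges"
    by metis
  from e(2) obtain t where "x = lin u v t" "t \<in> {0..1}" unfolding uv(1) segment_lin by (elim imageE)
  with uv that show ?thesis by metis
qed

lemma coord_lipschitz:
  assumes "x \<in> cayley_space G S" "y \<in> cayley_space G S"
  shows "\<bar>x w - y w\<bar> \<le> cayley_dist G S x y"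
proof -
  have "affine_ext (indicator {w}) x = x w" if x: "x \<in> cayley_space G S" for x
  proof -
    from pointE[OF x] obtain u v t where "x = lin u v t" by metis
    then have "affine_ext (indicator {w}) x = (1 - t) * indicator {w} u + t * indicator {w} v"
      by (simp only: affine_ext_lin)
    moreover have "x w = (1 - t) * indicator {u} w + t * indicator {v} w"
      by (simp add: \<open>x = lin u v t\<close> lin_def)
    ultimately have "affine_ext (indicator {w}) x = (1 - t) * indicator {w} u + t * indicator {w} v"
      and "x w = (1 - t) * indicator {u} w + t * indicator {v} w" .
    then show ?thesis by (simp add: indicator_def)
  qed
  moreover have "\<bar>indicator {w} u - indicator {w} v\<bar> \<le> (1::real)" for u v
    by (simp add: indicator_def)
  ultimately show ?thesis using affine_ext_lipschitz[of "indicator {w}", OF _ assms] assms by simp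
qed

lemma open_coord: "openin X.mtopology {x \<in> cayley_space G S. 0 < x w}"
  unfolding X.openin_mtopology
proof (intro conjI allI impI)
  fix x assume "x \<in> {x \<in> cayley_space G S. 0 < x w}"
  then have x: "x \<in> cayley_space G S" "0 < x w" by auto
  have "X.mball x (x w) \<subseteq> {x \<in> cayley_space G S. 0 < x w}"
  proof
    fix y assume "y \<in> X.mball x (x w)"
    then have y: "y \<in> cayley_space G S" "cayley_dist G S x y < x w" by auto
    from coord_lipschitz[OF x(1) y(1), of w] y(2) show "y \<in> {x \<in> cayley_space G S. 0 < x w}"
      using y(1) by auto
  qed
  with x(2) show "\<exists>r>0. X.mball x r \<subseteq> {x \<in> cayley_space G S. 0 < x w}"
    by (intro exI[of _ "x w"] conjI)
qed auto

lemma connected_segment: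
  assumes "(u, v) \<in> edges"
  shows "connectedin X.mtopology (segment u v)"
proof -
  have "pathin X.mtopology (lin u v)"
  proof (rule X.lipschitz_pathin[where L = 1])
    fix s t :: real assume st: "s \<in> {0..1}" "t \<in> {0..1}"
    have "lin u v s \<in> segment u v" unfolding segment_lin using st(1) by (rule imageI)
    then show "lin u v s \<in> cayley_space G S" by (rule subsetD[OF cell_subset[OF edge_cell[OF assms]]])
    show "cayley_dist G S (lin u v s) (lin u v t) \<le> 1 * \<bar>s - t\<bar>"
      using dist_lin[OF edge_cell[OF assms] st] by simp
  qed
  then show ?thesis unfolding segment_lin by (rule connectedin_path_image)
qed

text \<open>Balls contain finitely many vertices.\<close>

lemma infinite_vertices_unbounded:
  assumes "B \<subseteq> carrier G" "infinite B" "\<And>b. b \<in> B \<Longrightarrow> vtx b \<in> C"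
  shows "\<not> X.mbounded C"
proof
  assume "X.mbounded C"
  then obtain x r where xr: "C \<subseteq> X.mcball x r" unfolding X.mbounded_def by metis
  obtain b where b: "b \<in> B" using assms(2) by (metis finite.emptyI ex_in_conv)
  have "B \<subseteq> {y \<in> carrier G. gdist b y \<le> nat \<lceil>2 * r\<rceil>}"
  proof
    fix y assume y: "y \<in> B"
    have d: "cayley_dist G S x (vtx z) \<le> r" "x \<in> cayley_space G S" "vtx z \<in> cayley_space G S" if "z \<in> B" for z
      using subsetD[OF xr assms(3)[OF that]] by auto
    have "cayley_dist G S (vtx b) (vtx y) \<le> cayley_dist G S (vtx b) x + cayley_dist G S x (vtx y)"
      using d y b by (intro X.triangle) auto
    also have "\<dots> \<le> 2 * r" using d[OF y] d[OF b] X.commute[of "vtx b" x] by simp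
    finally have "real (gdist b y) \<le> 2 * r"
      using dist_vtx[OF subsetD[OF assms(1) b] subsetD[OF assms(1) y]] by simp
    then show "y \<in> {y \<in> carrier G. gdist b y \<le> nat \<lceil>2 * r\<rceil>}" using y assms(1) by (auto simp: le_nat_iff) linarith
  qed
  with finite_ball[of b] b assms(1,2) finite_subset show False by blast
qed

text \<open>A walk from a vertex outside of \<open>F\<close> into \<open>F\<close> passes through one of the finitely many neighbours of
  \<open>F\<close> before it enters \<open>F\<close> for the first time. By the pigeonhole principle one of them receives infinitely many
  elements of \<open>B\<close>.\<close>

lemma infinitely_many_joined:
  assumes "finite F" "F \<subseteq> carrier G" "F \<noteq> {}" "B \<subseteq> carrier G - F" "infinite B"
  obtains n B' where "n \<in> carrier G - F" "B' \<subseteq> B" "infinite B'" "\<And>b. b \<in> B' \<Longrightarrow> (n, b) \<in> (edges \<inter> (- F) \<times> (- F))\<^sup>*"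
proof -
  define Q where "Q = edges \<inter> (- F) \<times> (- F)"
  have symQ: "sym (Q\<^sup>*)" using sym_edges by (intro sym_rtrancl) (auto simp: Q_def sym_def)
  define N where "N = (\<lambda>(f, t). f \<otimes> t) ` (F \<times> gens) - F"
  have "finite N" using assms(1) finite_gens by (auto simp: N_def)
  obtain f where f: "f \<in> F" using assms(3) by blast
  have "\<exists>n\<in>N. (b, n) \<in> Q\<^sup>*" if "(b, f) \<in> edges\<^sup>*" "b \<notin> F" for b
    using that
  proof (induction rule: converse_rtrancl_induct)
    case (step b b')
    show ?case
    proof (cases "b' \<in> F")
      case True
      from edges_sym[OF step(1)] obtain t where "b = b' \<otimes> t" "t \<in> gens" by (auto simp: edges_def)
      then have "b \<in> N" using True step(4) unfolding N_def by force
      then show ?thesis by blast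
    next
      case False
      then obtain n where "n \<in> N" "(b', n) \<in> Q\<^sup>*" using step by blast
      moreover have "(b, b') \<in> Q" using step False by (auto simp: Q_def)
      ultimately show ?thesis by (meson converse_rtrancl_into_rtrancl)
    qed
  qed (use f in auto)
  then have "\<exists>n\<in>N. (b, n) \<in> Q\<^sup>*" if "b \<in> B" for b
    using that assms(2,4) f reach[of b f] by auto
  then obtain h where h: "\<And>b. b \<in> B \<Longrightarrow> h b \<in> N \<and> (b, h b) \<in> Q\<^sup>*" by metis
  then have "finite (h ` B)" using \<open>finite N\<close> by (meson finite_subset image_subsetI)
  from pigeonhole_infinite[OF assms(5) this] obtain b0 where
    b0: "b0 \<in> B" "infinite {b \<in> B. h b = h b0}" by blast
  show thesis
  proof
    have "N \<subseteq> carrier G - F" using assms(2) gens_subset by (auto simp: N_def intro!: m_closed)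
    then show "h b0 \<in> carrier G - F" using h[OF b0(1)] by blast
    show "(h b0, b) \<in> (edges \<inter> (- F) \<times> (- F))\<^sup>*" if "b \<in> {b \<in> B. h b = h b0}" for b
      using h[of b] that symQ unfolding Q_def[symmetric] by (auto dest: symD)
  qed (use b0 in auto)
qed

text \<open>Edges with both ends outside of \<open>F\<close> do not touch the vertices in \<open>F\<close>.\<close>

lemma joined_vertices_connected:
  assumes "(u, v) \<in> (edges \<inter> (- F) \<times> (- F))\<^sup>*" "u \<in> carrier G - F"
  shows "connected_component_of (subtopology X.mtopology (cayley_space G S - vtx ` F)) (vtx u) (vtx v)"
  using assms(1)
proof (induction rule: rtrancl_induct)
  case base
  have "vtx u w \<noteq> vtx f w" if "f \<in> F" "w = u" for f w
    using that assms(2) by (cases "f = u") (auto simp: vtx_def)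
  then have "vtx u \<notin> vtx ` F" by (metis imageE)
  then show ?case using vtx_in_space assms(2) by (simp add: connected_component_of_refl)
next
  case (step v w)
  then have vw: "(v, w) \<in> edges" "v \<notin> F" "w \<notin> F" by auto
  have "lin v w t \<noteq> vtx f" if "f \<in> F" for t f
  proof
    assume "lin v w t = vtx f"
    then have "lin v w t f = vtx f f" by simp
    moreover have "f \<noteq> v" "f \<noteq> w" using that vw by auto
    ultimately show False by (simp add: lin_def vtx_def)
  qed
  then have "segment v w \<inter> vtx ` F = {}" unfolding segment_lin by (metis (no_types, lifting) disjoint_iff imageE)
  then have "segment v w \<subseteq> cayley_space G S - vtx ` F"
    using cell_subset[OF edge_cell[OF vw(1)]] by (simp add: Diff_eq disjoint_eq_subset_Compl)
  then have "connectedin (subtopology X.mtopology (cayley_space G S - vtx ` F)) (segment v w)"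
    using connected_segment[OF vw(1)] by (simp add: connectedin_subtopology)
  moreover have "vtx v \<in> segment v w" "vtx w \<in> segment v w"
    using vtx_segment segment_swap by metis+
  ultimately have "connected_component_of (subtopology X.mtopology (cayley_space G S - vtx ` F)) (vtx v) (vtx w)"
    unfolding connected_component_of_def by metis
  with step.IH show ?case by (rule connected_component_of_trans)
qed

text \<open>Here \<open>F\<close> is the inner vertex boundary of \<open>A\<close>. Once it is removed, no path leads from \<open>A\<close> out of \<open>A\<close>:
  the points with a positive coordinate in \<open>A - F\<close> form an open set, and so do the remaining ones.\<close>

lemma boundary_separates:
  assumes F: "F = {x \<in> A. \<exists>t\<in>gens. x \<otimes> t \<notin> A}" and A: "A \<subseteq> carrier G" "a \<in> A - F" "b \<in> carrier G - A"
  shows "\<not> connected_component_of (subtopology X.mtopology (cayley_space G S - vtx ` F)) (vtx a) (vtx b)"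
proof
  let ?W = "subtopology X.mtopology (cayley_space G S - vtx ` F)"
  let ?P = "\<lambda>w. {x \<in> cayley_space G S. 0 < x w}"
  assume "connected_component_of ?W (vtx a) (vtx b)"
  then obtain C where C: "connectedin ?W C" "vtx a \<in> C" "vtx b \<in> C"
    unfolding connected_component_of_def by metis
  then have CW: "C \<subseteq> cayley_space G S - vtx ` F" and CX: "connectedin X.mtopology C"
    by (auto simp: connectedin_subtopology)
  \<comment> \<open>A point outside of \<open>U1\<close> that is not a vertex in \<open>F\<close> has a positive coordinate outside of \<open>A\<close>,
    or it is interior to an edge between two vertices of \<open>F\<close>.\<close>
  define U1 where "U1 = (\<Union>w\<in>A - F. ?P w)"
  define U2 where "U2 = (\<Union>w\<in>carrier G - A. ?P w) \<union> (\<Union>u\<in>F. \<Union>v\<in>F - {u}. ?P u \<inter> ?P v)"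
  have o1: "openin X.mtopology U1"
    unfolding U1_def by (intro openin_Union ballI) (auto intro: open_coord)
  have o2: "openin X.mtopology U2"
    unfolding U2_def by (intro openin_Un openin_Union ballI) (auto intro!: open_coord openin_Int openin_Union)
  have exit: "w \<in> F" if "w \<in> A" "(w, w') \<in> edges" "w' \<notin> A" for w w'
    using that by (auto simp: F edges_def)
  have supp: "w = u \<or> w = v" if "0 < lin u v t w" for u v t w
    using that by (cases "w = u"; cases "w = v") (auto simp: lin_def)
  have cover: "C \<subseteq> U1 \<union> U2"
  proof
    fix x assume "x \<in> C"
    then have x: "x \<in> cayley_space G S" "x \<notin> vtx ` F" using CW by auto
    have vert: "x \<in> U1 \<union> U2" if "x = vtx u" "u \<in> carrier G" for u
    proof -
      have "0 < x u" "u \<notin> F" using that x(2) by (auto simp: vtx_def)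
      then have "u \<in> A - F \<or> u \<in> carrier G - A" "x \<in> ?P u" using x(1) that(2) by auto
      then show ?thesis unfolding U1_def U2_def by blast
    qed
    from pointE[OF x(1)] obtain u v t where p: "x = lin u v t" "t \<in> {0..1}"
      "u \<in> carrier G" "v \<in> carrier G" by metis
    show "x \<in> U1 \<union> U2"
    proof (cases "u = v \<or> t = 0 \<or> t = 1")
      case True
      then show ?thesis using vert[of u] vert[of v] p by auto
    next
      case False
      then have "0 < x u" "0 < x v" "u \<noteq> v" using p by (auto simp: lin_def)
      then have "x \<in> ?P u" "x \<in> ?P v" "v \<noteq> u" using x(1) by auto
      moreover have "(u \<in> A - F \<or> u \<in> carrier G - A \<or> u \<in> F) \<and> (v \<in> A - F \<or> v \<in> carrier G - A \<or> v \<in> F)"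
        using p(3,4) by blast
      ultimately show ?thesis unfolding U1_def U2_def by blast
    qed
  qed
  have disj: "U1 \<inter> U2 \<inter> C = {}"
  proof (rule equals0I)
    fix x assume x: "x \<in> U1 \<inter> U2 \<inter> C"
    then obtain w where w: "w \<in> A - F" "0 < x w" and xs: "x \<in> cayley_space G S" by (auto simp: U1_def)
    from pointE[OF xs] obtain u v t where p: "x = lin u v t" "u = v \<or> (u, v) \<in> edges" by metis
    from x consider w' where "w' \<notin> A" "0 < x w'"
      | u' v' where "u' \<in> F" "v' \<in> F" "u' \<noteq> v'" "0 < x u'" "0 < x v'" by (auto simp: U2_def)
    then show False
    proof cases
      case 1
      then have "(w, w') \<in> edges" using w supp p edges_sym by (metis DiffD1)
      with exit 1 w show False by auto
    next
      case 2
      then show False using w supp p(1) by (metis DiffD2)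
    qed
  qed
  have "vtx a \<in> ?P a" "vtx b \<in> ?P b"
    using A vtx_in_space[of a] vtx_in_space[of b] by (auto simp: vtx_def)
  then have "vtx a \<in> U1" "vtx b \<in> U2" using A(2,3) unfolding U1_def U2_def by blast+
  with connectedinD[OF CX o1 o2 cover disj] C show False by auto
qed

text \<open>The Cayley graph of a finite group is bounded and has no unbounded component. If \<open>A\<close> and its complement were both infinite while \<open>A\<close> has finite boundary, then each of them would
  contribute an unbounded component after removal of the inner boundary of \<open>A\<close>. A finite vertex set is
  compact, so these two components coincide, in contradiction to the preceding lemma.\<close>

lemma one_ended_imp:
  assumes "X.one_ended"
  shows one_ended_imp_infinite: "infinite (carrier G)"
    and one_ended_imp_property: "one_end_property G"
proof -
  show "infinite (carrier G)"
  proof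
    assume fin: "finite (carrier G)"
    from assms obtain C where C: "C \<in> connected_components_of (subtopology X.mtopology (cayley_space G S - {}))"
      "\<not> X.mbounded C"
      unfolding X.one_ended_def by (metis compactin_empty)
    define r where "r = real (Max (gdist \<one> ` carrier G)) + 1"
    have "cayley_space G S \<subseteq> X.mcball (vtx \<one>) r"
    proof
      fix x assume x: "x \<in> cayley_space G S"
      from near_vertex[OF this] obtain u where u: "u \<in> carrier G" "X.joined UNIV 1 x (vtx u)" by metis
      have "cayley_dist G S (vtx \<one>) x \<le> cayley_dist G S (vtx \<one>) (vtx u) + cayley_dist G S (vtx u) x"
        using x u vtx_in_space by (intro X.triangle) auto
      also have "\<dots> \<le> r"
      proof -
        have "gdist \<one> u \<le> Max (gdist \<one> ` carrier G)" using fin u(1) by simp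
        then show ?thesis
          using joined_dist[OF X.joined_sym[OF u(2)]] by (simp add: dist_vtx u(1) r_def)
      qed
      finally show "x \<in> X.mcball (vtx \<one>) r" using x vtx_in_space by simp
    qed
    moreover have "C \<subseteq> cayley_space G S" using connected_components_of_subset[OF C(1)] by simp
    ultimately show False using C(2) unfolding X.mbounded_def by (meson order_trans)
  qed
  show "one_end_property G"
    unfolding one_end_property_def
  proof (intro allI impI, rule ccontr)
    fix A assume A: "A \<subseteq> carrier G" "\<forall>g\<in>carrier G. finite {x \<in> A. x \<otimes> g \<notin> A}"
      and "\<not> (finite A \<or> finite (carrier G - A))"
    then have inf: "infinite A" "infinite (carrier G - A)" by auto
    define F where "F = {x \<in> A. \<exists>t\<in>gens. x \<otimes> t \<notin> A}"
    let ?W = "subtopology X.mtopology (cayley_space G S - vtx ` F)"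
    have "F = (\<Union>t\<in>gens. {x \<in> A. x \<otimes> t \<notin> A})" by (auto simp: F_def)
    then have fin: "finite F" using A(2) finite_gens gens_subset by auto
    have FG: "F \<subseteq> carrier G" using A(1) by (auto simp: F_def)
    have "F \<noteq> {}"
    proof
      assume "F = {}"
      obtain a b where ab: "a \<in> A" "b \<in> carrier G" "b \<notin> A" using inf by (metis DiffD1 DiffD2 finite.emptyI ex_in_conv)
      have "(a, b) \<in> edges\<^sup>*" using ab A(1) by (intro reach) auto
      then have "b \<in> A"
        by (induction rule: rtrancl_induct) (use ab \<open>F = {}\<close> in \<open>auto simp: F_def edges_def\<close>)
      with ab show False by simp
    qed
    have outer_comp: "\<exists>C b. C \<in> connected_components_of ?W \<and> \<not> X.mbounded C \<and> b \<in> B \<and> vtx b \<in> C"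
      if B: "B \<subseteq> carrier G - F" "infinite B" for B
    proof -
      obtain n B' where n: "n \<in> carrier G - F" "B' \<subseteq> B" "infinite B'"
        "\<And>b. b \<in> B' \<Longrightarrow> (n, b) \<in> (edges \<inter> (- F) \<times> (- F))\<^sup>*"
        using infinitely_many_joined[OF fin FG \<open>F \<noteq> {}\<close> B] by metis
      let ?C = "connected_component_of_set ?W (vtx n)"
      have in_C: "vtx b \<in> ?C" if "b \<in> B'" for b
        using joined_vertices_connected[OF n(4)[OF that] n(1)] by simp
      obtain b where b: "b \<in> B'" using n(3) by (metis finite.emptyI ex_in_conv)
      have "vtx n \<in> topspace ?W" using in_C[OF b] connected_component_in_topspace[of ?W "vtx n" "vtx b"] by blast
      then have "?C \<in> connected_components_of ?W" by (simp add: connected_components_of_def)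
      moreover have "\<not> X.mbounded ?C"
        using n(2,3) B(1) in_C by (intro infinite_vertices_unbounded[of B']) auto
      ultimately show ?thesis using b n(2) in_C by blast
    qed
    have "infinite (A - F)" using inf(1) fin by (simp add: Diff_infinite_finite)
    moreover have "A - F \<subseteq> carrier G - F" "carrier G - A \<subseteq> carrier G - F" using A(1) by (auto simp: F_def)
    ultimately obtain C a C' b where
      C: "C \<in> connected_components_of ?W" "\<not> X.mbounded C" "a \<in> A - F" "vtx a \<in> C" and
      C': "C' \<in> connected_components_of ?W" "\<not> X.mbounded C'" "b \<in> carrier G - A" "vtx b \<in> C'"
      using outer_comp inf(2) by metis
    have "compactin X.mtopology (vtx ` F)"
      using fin FG vtx_in_space by (intro finite_imp_compactin) auto
    then have "C = C'" using assms C C' unfolding X.one_ended_def by metis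
    then have "connected_component_of ?W (vtx a) (vtx b)"
      using C C' connectedin_connected_components_of unfolding connected_component_of_def by metis
    with boundary_separates[OF F_def A(1) C(3) C'(3)] show False by blast
  qed
qed

end

section \<open>Finite presentations and local cocycles\<close>

lemma free_group_simps:
  "carrier (free_group X) = {w \<in> lists (UNIV \<times> X). reduced_word w}"
  "u \<otimes>\<^bsub>free_group X\<^esub> v = foldr push u v"
  "\<one>\<^bsub>free_group X\<^esub> = []"
  by (simp_all add: free_group_def)

text \<open>The isomorphism with the quotient of the free group, read as an epimorphism from the free group whose
  kernel is the normal closure of the relators.\<close>

lemma finitely_presented_hom:
  fixes G :: "('a, 'b) monoid_scheme"
  assumes "group G" "finitely_presented G"
  obtains k :: nat and R \<phi> where "finite R" "R \<subseteq> carrier (free_group {..<k})"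
    "\<phi> \<in> hom (free_group {..<k}) G" "\<phi> ` carrier (free_group {..<k}) = carrier G"
    "\<And>w. w \<in> carrier (free_group {..<k}) \<Longrightarrow> \<phi> w = \<one>\<^bsub>G\<^esub> \<Longrightarrow> w \<in> normal_closure (free_group {..<k}) R"
    "\<And>r. r \<in> R \<Longrightarrow> \<phi> r = \<one>\<^bsub>G\<^esub>"
proof -
  obtain k :: nat and R where R: "finite R" "R \<subseteq> carrier (free_group {..<k})"
    "G \<cong> free_group {..<k} Mod normal_closure (free_group {..<k}) R"
    using assms(2) unfolding finitely_presented_def by metis
  define F where "F = free_group {..<k}"
  define N where "N = normal_closure F R"
  interpret G: group G by fact
  interpret F: group F unfolding F_def by (rule group_free_group)
  interpret N: normal N F unfolding N_def F_def
    by (rule normal_normal_closure[OF group_free_group R(2)])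
  have "F Mod N \<cong> G"
    using R(3) G.iso_sym by (simp add: F_def N_def)
  then obtain f where f: "f \<in> iso (F Mod N) G" by (auto simp: is_iso_def)
  interpret Q: group "F Mod N" by (rule N.factorgroup_is_group)
  interpret f: group_hom "F Mod N" G f
    using f by unfold_locales (auto simp: iso_def)
  define \<phi> where "\<phi> w = f (N #>\<^bsub>F\<^esub> w)" for w
  have hom: "\<phi> \<in> hom F G"
    using hom_compose[OF N.r_coset_hom_Mod f.homh] by (simp add: \<phi>_def[abs_def] o_def)
  have inj: "inj_on f (carrier (F Mod N))" and surj: "f ` carrier (F Mod N) = carrier G"
    using f by (auto simp: iso_def bij_betw_def)
  have ker: "\<phi> w = \<one>\<^bsub>G\<^esub> \<longleftrightarrow> w \<in> N" if "w \<in> carrier F" for w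
  proof -
    have "\<phi> w = \<one>\<^bsub>G\<^esub> \<longleftrightarrow> f (N #>\<^bsub>F\<^esub> w) = f \<one>\<^bsub>F Mod N\<^esub>"
      by (simp only: \<phi>_def f.hom_one)
    also have "\<dots> \<longleftrightarrow> N #>\<^bsub>F\<^esub> w = \<one>\<^bsub>F Mod N\<^esub>"
      using that by (intro inj_on_eq_iff[OF inj _ Q.one_closed]) (auto simp: FactGroup_def RCOSETS_def)
    also have "\<dots> \<longleftrightarrow> w \<in> N"
      using that F.coset_join1[of N w] F.coset_join2[of w N] N.subgroup_axioms N.subset
      by (auto simp: FactGroup_def)
    finally show ?thesis .
  qed
  have onto: "\<phi> ` carrier F = carrier G"
  proof -
    have "carrier (F Mod N) = (\<lambda>w. N #>\<^bsub>F\<^esub> w) ` carrier F" by (auto simp: FactGroup_def RCOSETS_def)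
    then show ?thesis using surj by (simp add: \<phi>_def image_image)
  qed
  have "R \<subseteq> N"
  proof
    fix r assume r: "r \<in> R"
    then have rF: "r \<in> carrier F" using R(2) by (auto simp: F_def)
    have "\<one>\<^bsub>F\<^esub> \<otimes>\<^bsub>F\<^esub> r \<otimes>\<^bsub>F\<^esub> inv\<^bsub>F\<^esub> \<one>\<^bsub>F\<^esub> \<in> N"
      unfolding N_def normal_closure_def using r by (intro generate.incl) blast
    then show "r \<in> N" using rF by simp
  qed
  then have "\<phi> r = \<one>\<^bsub>G\<^esub>" if "r \<in> R" for r
    using that ker[of r] R(2) by (auto simp: F_def)
  with R hom onto ker that show ?thesis unfolding F_def N_def by metis
qed

context cayley_graph
begin

text \<open>A 1-cocycle with coefficients modulo 2 on the Rips complex of scale \<open>D\<close>; exclusive disjunction is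
  written as \<open>\<noteq>\<close> on truth values.\<close>

definition local_cocycle :: "nat \<Rightarrow> ('a \<Rightarrow> 'a \<Rightarrow> bool) \<Rightarrow> bool" where
  "local_cocycle D f \<longleftrightarrow> (\<forall>u\<in>carrier G. \<forall>v\<in>carrier G. \<forall>w\<in>carrier G.
     gdist u v \<le> D \<longrightarrow> gdist v w \<le> D \<longrightarrow> gdist u w \<le> D \<longrightarrow> f u w = (f u v \<noteq> f v w))"

lemma local_cocycle_mono: "local_cocycle D f \<Longrightarrow> D' \<le> D \<Longrightarrow> local_cocycle D' f"
  unfolding local_cocycle_def by (meson order_trans)

text \<open>Local cocycles restrict to coboundaries on the Cayley graph. This is the part of coarse simple
  connectedness that the cutting argument below consumes.\<close>

definition H1_trivial_at :: "nat \<Rightarrow> bool" where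
  "H1_trivial_at D \<longleftrightarrow> (\<forall>f. local_cocycle D f \<longrightarrow>
     (\<exists>h::'a \<Rightarrow> bool. \<forall>u v. (u, v) \<in> edges \<longrightarrow> (f u v \<longleftrightarrow> h u \<noteq> h v)))"

lemma H1_trivial_at_mono: "H1_trivial_at D \<Longrightarrow> D \<le> D' \<Longrightarrow> H1_trivial_at D'"
  unfolding H1_trivial_at_def by (blast intro: local_cocycle_mono)

lemma local_cocycleD:
  assumes "local_cocycle D f" "u \<in> carrier G" "v \<in> carrier G" "w \<in> carrier G"
    "gdist u v \<le> D" "gdist v w \<le> D" "gdist u w \<le> D"
  shows "f u w \<longleftrightarrow> f u v \<noteq> f v w"
  using assms unfolding local_cocycle_def by blast

text \<open>A word whose letters are sent to group elements by \<open>e\<close> describes a walk starting at \<open>g\<close>. The holonomy sums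
  \<open>f\<close> modulo 2 along its steps.\<close>

primrec endpoint :: "('x \<Rightarrow> 'a) \<Rightarrow> 'a \<Rightarrow> 'x list \<Rightarrow> 'a" where
  "endpoint e g [] = g"
| "endpoint e g (l # w) = endpoint e (g \<otimes> e l) w"

primrec trace :: "('x \<Rightarrow> 'a) \<Rightarrow> 'a \<Rightarrow> 'x list \<Rightarrow> 'a set" where
  "trace e g [] = {g}"
| "trace e g (l # w) = insert g (trace e (g \<otimes> e l) w)"

primrec holonomy :: "('a \<Rightarrow> 'a \<Rightarrow> bool) \<Rightarrow> ('x \<Rightarrow> 'a) \<Rightarrow> 'a \<Rightarrow> 'x list \<Rightarrow> bool" where
  "holonomy f e g [] = False"
| "holonomy f e g (l # w) = (f g (g \<otimes> e l) \<noteq> holonomy f e (g \<otimes> e l) w)"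

lemma finite_trace: "finite (trace e g w)"
  by (induction w arbitrary: g) auto

lemma trace_carrier:
  assumes "range e \<subseteq> carrier G" "g \<in> carrier G"
  shows "trace e g w \<subseteq> carrier G"
  using assms(2)
proof (induction w arbitrary: g)
  case (Cons l w)
  have "e l \<in> carrier G" using assms(1) by blast
  then have "g \<otimes> e l \<in> carrier G" using Cons.prems by simp
  from Cons.IH[OF this] Cons.prems show ?case by simp
qed simp

lemma start_in_trace: "g \<in> trace e g w"
  by (cases w) auto

lemma endpoint_in_trace: "endpoint e g w \<in> trace e g w"
  by (induction w arbitrary: g) auto

lemma trace_translate:
  assumes "range e \<subseteq> carrier G" "g \<in> carrier G" "h \<in> carrier G"
  shows "trace e (h \<otimes> g) w = (\<lambda>x. h \<otimes> x) ` trace e g w"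
  using assms(2)
proof (induction w arbitrary: g)
  case (Cons l w)
  have "e l \<in> carrier G" using assms(1) by auto
  with Cons assms(3) show ?case by (simp add: m_assoc)
qed simp

text \<open>While all vertices of the walk are within the scale of the cocycle, two consecutive steps can be
  replaced by one, and in the end only the step from the first to the last vertex is left.\<close>

lemma holonomy_telescope:
  assumes f: "local_cocycle D f" and e: "range e \<subseteq> carrier G"
    and "g \<in> carrier G" "\<And>x y. x \<in> trace e g w \<Longrightarrow> y \<in> trace e g w \<Longrightarrow> gdist x y \<le> D"
  shows "holonomy f e g w = f g (endpoint e g w)"
  using assms(3,4)
proof (induction w arbitrary: g)
  case Nil
  then show ?case using local_cocycleD[OF f, of g g g] by auto
next
  case (Cons l w)
  let ?h = "g \<otimes> e l"
  have h: "?h \<in> carrier G" using Cons.prems(1) e by auto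
  have z: "endpoint e ?h w \<in> carrier G" using endpoint_in_trace trace_carrier[OF e h] by blast
  have "holonomy f e ?h w = f ?h (endpoint e ?h w)"
    using Cons.prems by (intro Cons.IH h) auto
  moreover have "f g (endpoint e ?h w) = (f g ?h \<noteq> f ?h (endpoint e ?h w))"
  proof (intro local_cocycleD[OF f] Cons.prems h z)
    show "?h \<in> trace e g (l # w)" "endpoint e ?h w \<in> trace e g (l # w)"
      "?h \<in> trace e g (l # w)" "endpoint e ?h w \<in> trace e g (l # w)"
      using start_in_trace[of ?h e w] endpoint_in_trace[of e ?h w] by simp_all
  qed simp_all
  ultimately show ?case by simp
qed

text \<open>By left invariance the diameter of a walk depends on the word only, not on the starting point.\<close>

lemma ex_diameter:
  assumes "finite W" "range e \<subseteq> carrier G"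
  obtains D where "\<And>w g x y. w \<in> W \<Longrightarrow> g \<in> carrier G \<Longrightarrow> x \<in> trace e g w \<Longrightarrow> y \<in> trace e g w \<Longrightarrow> gdist x y \<le> D"
proof
  define P where "P = (\<Union>w\<in>W. (\<lambda>(x, y). gdist x y) ` (trace e \<one> w \<times> trace e \<one> w))"
  have "finite P"
    unfolding P_def by (intro finite_UN_I finite_imageI finite_cartesian_product assms(1) finite_trace)
  fix w g x y assume w: "w \<in> W" "g \<in> carrier G" "x \<in> trace e g w" "y \<in> trace e g w"
  then obtain x' y' where x': "x = g \<otimes> x'" "y = g \<otimes> y'" "x' \<in> trace e \<one> w" "y' \<in> trace e \<one> w"
    using trace_translate[OF assms(2) one_closed w(2), of w] by auto
  then have "gdist x y = gdist x' y'"
    using trace_carrier[OF assms(2) one_closed, of w] w(2) by (auto intro: gdist_translate)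
  also have "\<dots> \<in> P" using x' w(1) by (force simp: P_def)
  finally show "gdist x y \<le> Max P" using \<open>finite P\<close> by simp
qed


text \<open>The scale \<open>D\<close> is chosen so large that the loops of all relators, and the walks of fixed words that
  represent the generators, have diameter at most \<open>D\<close>. By telescoping, a cocycle \<open>f\<close> then sums to 0 along
  each relator loop, wherever it starts. The words that lead back to the start with sum 0 from every
  starting point form a subgroup of the free group that contains the conjugates of the relators, hence
  the whole kernel of the presentation. So the sum of \<open>f\<close> along a word starting at the identity depends only
  on the element that the word represents; it is the potential \<open>h\<close>. That its differences along the edges
  are given by \<open>f\<close> is once more telescoping, for the words representing the generators.\<close>

lemma finitely_presented_imp_H1_trivial:
  assumes "finitely_presented G"
  obtains D where "H1_trivial_at D"
proof -
  obtain k :: nat and R \<phi> where R: "finite R" "R \<subseteq> carrier (free_group {..<k})"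
    and hom: "\<phi> \<in> hom (free_group {..<k}) G" and onto: "\<phi> ` carrier (free_group {..<k}) = carrier G"
    and ker: "\<And>w. w \<in> carrier (free_group {..<k}) \<Longrightarrow> \<phi> w = \<one> \<Longrightarrow> w \<in> normal_closure (free_group {..<k}) R"
    and R1: "\<And>r. r \<in> R \<Longrightarrow> \<phi> r = \<one>"
    using finitely_presented_hom[OF group_axioms assms] by metis
  define F where "F = free_group {..<k}"
  interpret F: group F unfolding F_def by (rule group_free_group)
  interpret \<phi>: group_hom F G \<phi> using hom by unfold_locales (simp add: F_def)
  have F_mult: "u \<otimes>\<^bsub>F\<^esub> v = foldr push u v" and F_one: "\<one>\<^bsub>F\<^esub> = []" for u v
    by (simp_all add: F_def free_group_simps)
  let ?L = "UNIV \<times> {..<k} :: (bool \<times> nat) set"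
  have F_carrier: "w \<in> carrier F \<longleftrightarrow> set w \<subseteq> ?L \<and> reduced_word w" for w
    by (auto simp: F_def free_group_simps)
  \<comment> \<open>Letters outside of the alphabet get the neutral element, so that \<open>e\<close> is total with values in \<open>G\<close>.\<close>
  define e where "e l = (if l \<in> ?L then \<phi> [l] else \<one>)" for l
  have single: "[l] \<in> carrier F" if "l \<in> ?L" for l
    using that by (simp add: F_carrier reduced_word_def)
  have e_carrier: "range e \<subseteq> carrier G" using single by (auto simp: e_def)
  have e_in: "e l \<in> carrier G" for l using e_carrier by blast
  have e_inv: "e l \<otimes> e (letter_inv l) = \<one>" for l
  proof (cases "l \<in> ?L")
    case True
    then have l': "letter_inv l \<in> ?L" by (auto simp: letter_inv_def)
    have "\<phi> [l] \<otimes> \<phi> [letter_inv l] = \<phi> ([l] \<otimes>\<^bsub>F\<^esub> [letter_inv l])"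
      using single True l' by simp
    also have "[l] \<otimes>\<^bsub>F\<^esub> [letter_inv l] = \<one>\<^bsub>F\<^esub>" by (simp add: F_mult F_one)
    finally show ?thesis using True l' by (simp add: e_def)
  next
    case False
    then have "letter_inv l \<notin> ?L" by (cases l) (auto simp: letter_inv_def)
    with False show ?thesis by (simp add: e_def)
  qed
  have endpoint: "endpoint e g w = g \<otimes> \<phi> w" if "w \<in> carrier F" "g \<in> carrier G" for g w
    using that
  proof (induction w arbitrary: g)
    case Nil
    then show ?case using \<phi>.hom_one by (simp add: F_one)
  next
    case (Cons l w)
    have lw: "l \<in> ?L" "w \<in> carrier F"
      using Cons.prems(1) by (cases w; auto simp: F_carrier reduced_word_def)+
    have "[l] \<otimes>\<^bsub>F\<^esub> w = l # w"
      using Cons.prems(1) by (cases w) (auto simp: F_mult F_carrier reduced_word_def)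
    then have "\<phi> (l # w) = e l \<otimes> \<phi> w"
      using \<phi>.hom_mult[OF single[OF lw(1)] lw(2)] lw(1) by (simp add: e_def)
    then show ?case using Cons.IH[OF lw(2)] Cons.prems(2) lw e_in by (simp add: m_assoc)
  qed
  have "\<exists>w. w \<in> carrier F \<and> \<phi> w = g" if "g \<in> carrier G" for g
  proof -
    have "g \<in> \<phi> ` carrier F" using that onto by (simp add: F_def)
    then show ?thesis by (elim imageE) blast
  qed
  then obtain word where word: "\<And>g. g \<in> carrier G \<Longrightarrow> word g \<in> carrier F \<and> \<phi> (word g) = g" by metis
  \<comment> \<open>The one-letter words are included for the symmetry of \<open>f\<close> on the steps of a walk, which makes the sum of
    \<open>f\<close> invariant under free reduction.\<close>
  define W where "W = R \<union> word ` gens \<union> (\<lambda>l. [l]) ` ?L"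
  have "finite W" using R(1) finite_gens by (simp add: W_def)
  from ex_diameter[OF this e_carrier] obtain D where
    D: "\<And>w g x y. w \<in> W \<Longrightarrow> g \<in> carrier G \<Longrightarrow> x \<in> trace e g w \<Longrightarrow> y \<in> trace e g w \<Longrightarrow> gdist x y \<le> D" by metis
  have "\<exists>h::'a \<Rightarrow> bool. \<forall>u v. (u, v) \<in> edges \<longrightarrow> (f u v \<longleftrightarrow> h u \<noteq> h v)" if f: "local_cocycle D f" for f
  proof -
    have f_refl: "\<not> f g g" if "g \<in> carrier G" for g
      using local_cocycleD[OF f that that that] by simp
    have f_back: "f g (g \<otimes> e l) = f (g \<otimes> e l) g" if g: "g \<in> carrier G" for g l
    proof (cases "l \<in> ?L")
      case True
      have "gdist g (g \<otimes> e l) \<le> D" "gdist (g \<otimes> e l) g \<le> D"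
        using D[of "[l]" g] True g by (auto simp: W_def)
      with local_cocycleD[OF f g _ g, of "g \<otimes> e l"] f_refl[OF g] show ?thesis using g e_in by auto
    qed (use g in \<open>simp add: e_def\<close>)
    have holonomy_push: "holonomy f e g (push l w) = holonomy f e g (l # w)" if "g \<in> carrier G" for g l w
    proof (cases "w \<noteq> [] \<and> hd w = letter_inv l")
      case True
      then obtain w' where w: "w = letter_inv l # w'" by (cases w) auto
      have "g \<otimes> e l \<otimes> e (letter_inv l) = g" using that e_in e_inv by (simp add: m_assoc)
      then show ?thesis using f_back[OF that, of l] by (auto simp: w)
    qed (cases w; simp)
    have holonomy_mult: "holonomy f e g (u \<otimes>\<^bsub>F\<^esub> w) = (holonomy f e g u \<noteq> holonomy f e (endpoint e g u) w)"
      if "g \<in> carrier G" for g u w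
      using that
    proof (induction u arbitrary: g)
      case (Cons l u)
      have "g \<otimes> e l \<in> carrier G" using Cons.prems e_in by simp
      then show ?case using Cons by (auto simp: F_mult holonomy_push)
    qed (simp add: F_mult)
    have holonomy_W: "holonomy f e g w = f g (g \<otimes> \<phi> w)" if "w \<in> W" "w \<in> carrier F" "g \<in> carrier G" for g w
      using holonomy_telescope[OF f e_carrier that(3) D[OF that(1,3)]] endpoint[OF that(2,3)] by simp
    define K where "K = {w \<in> carrier F. \<phi> w = \<one> \<and> (\<forall>g\<in>carrier G. \<not> holonomy f e g w)}"
    have holonomy_inv: "holonomy f e (g \<otimes> \<phi> w) (inv\<^bsub>F\<^esub> w) = holonomy f e g w" if "w \<in> carrier F" "g \<in> carrier G" for w g
      using holonomy_mult[OF that(2), of w "inv\<^bsub>F\<^esub> w"] endpoint[OF that] that(1) F.r_inv[OF that(1)]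
      by (auto simp: F_one)
    have "subgroup K F"
    proof (rule F.subgroupI)
      show "K \<noteq> {}" using F.one_closed \<phi>.hom_one by (auto simp: K_def F_one intro!: exI[of _ "[]"])
      show "inv\<^bsub>F\<^esub> w \<in> K" if "w \<in> K" for w
        using that holonomy_inv[of w] by (auto simp: K_def)
      show "u \<otimes>\<^bsub>F\<^esub> w \<in> K" if "u \<in> K" "w \<in> K" for u w
        using that holonomy_mult[of _ u w] endpoint[of u] by (auto simp: K_def)
    qed (auto simp: K_def)
    moreover have "g \<otimes>\<^bsub>F\<^esub> r \<otimes>\<^bsub>F\<^esub> inv\<^bsub>F\<^esub> g \<in> K" if "g \<in> carrier F" "r \<in> R" for g r
    proof -
      have r: "r \<in> carrier F" "\<phi> r = \<one>" "r \<in> W" using that R(2) R1 by (auto simp: F_def W_def)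
      have "\<not> holonomy f e x (g \<otimes>\<^bsub>F\<^esub> r \<otimes>\<^bsub>F\<^esub> inv\<^bsub>F\<^esub> g)" if x: "x \<in> carrier G" for x
      proof -
        have xg: "x \<otimes> \<phi> g \<in> carrier G" using x \<open>g \<in> carrier F\<close> by simp
        have "\<not> holonomy f e (x \<otimes> \<phi> g) r" using holonomy_W[OF r(3,1) xg] r(2) f_refl[OF xg] xg by simp
        then have "holonomy f e x (g \<otimes>\<^bsub>F\<^esub> r) = holonomy f e x g"
          using holonomy_mult[OF x, of g r] endpoint[OF \<open>g \<in> carrier F\<close> x] by simp
        moreover have "endpoint e x (g \<otimes>\<^bsub>F\<^esub> r) = x \<otimes> \<phi> g"
          using endpoint[of "g \<otimes>\<^bsub>F\<^esub> r" x] x r \<open>g \<in> carrier F\<close> by simp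
        ultimately show ?thesis
          using holonomy_mult[OF x, of "g \<otimes>\<^bsub>F\<^esub> r" "inv\<^bsub>F\<^esub> g"] holonomy_inv[OF \<open>g \<in> carrier F\<close> x] by simp
      qed
      then show ?thesis using that r by (simp add: K_def)
    qed
    then have "{g \<otimes>\<^bsub>F\<^esub> r \<otimes>\<^bsub>F\<^esub> inv\<^bsub>F\<^esub> g | g r. g \<in> carrier F \<and> r \<in> R} \<subseteq> K" by blast
    ultimately have NK: "normal_closure F R \<subseteq> K"
      unfolding normal_closure_def by (intro F.generate_subgroup_incl)
    have well_def: "holonomy f e \<one> w = holonomy f e \<one> w'"
      if "w \<in> carrier F" "w' \<in> carrier F" "\<phi> w = \<phi> w'" for w w'
    proof -
      let ?n = "inv\<^bsub>F\<^esub> w \<otimes>\<^bsub>F\<^esub> w'"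
      have n: "?n \<in> carrier F" "\<phi> ?n = \<one>" using that by auto
      then have "?n \<in> K" using ker NK unfolding F_def by blast
      then have "\<not> holonomy f e (endpoint e \<one> w) ?n" using that(1) endpoint by (simp add: K_def)
      moreover have "w \<otimes>\<^bsub>F\<^esub> ?n = w'" using that by (simp add: F.m_assoc[symmetric])
      ultimately show ?thesis using holonomy_mult[OF one_closed, of w ?n] by simp
    qed
    define h where "h g = holonomy f e \<one> (word g)" for g
    have "f u v \<longleftrightarrow> h u \<noteq> h v" if "(u, v) \<in> edges" for u v
    proof -
      from that obtain t where t: "u \<in> carrier G" "t \<in> gens" "v = u \<otimes> t" by (auto simp: edges_def)
      have tG: "t \<in> carrier G" using t(2) gens_subset by blast
      note w = word[OF t(1)] word[OF tG]
      have "h v = holonomy f e \<one> (word u \<otimes>\<^bsub>F\<^esub> word t)"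
        unfolding h_def using w word[of v] t tG by (intro well_def) auto
      also have "\<dots> = (h u \<noteq> holonomy f e u (word t))"
        using holonomy_mult[OF one_closed, of "word u" "word t"] endpoint[of "word u" \<one>] w t(1) by (simp add: h_def)
      also have "holonomy f e u (word t) = f u v"
        using holonomy_W[of "word t" u] w t by (simp add: W_def)
      finally show ?thesis by blast
    qed
    then show ?thesis by (intro exI[of _ h]) simp
  qed
  then have "H1_trivial_at D" unfolding H1_trivial_at_def by blast
  with that show thesis by blast
qed

end

section \<open>Going around a ball\<close>

context cayley_graph
begin

definition walk_in :: "'a set \<Rightarrow> ('a \<times> 'a) set" where
  "walk_in Y = (edges \<inter> Y \<times> Y)\<^sup>*"

definition outer :: "'a \<Rightarrow> nat \<Rightarrow> 'a set" where
  "outer c \<rho> = {v \<in> carrier G. \<rho> < gdist c v}"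

text \<open>The component of \<open>a\<close> in the complement of the ball. It is \<open>{a}\<close>, not empty, if \<open>a\<close> lies in the ball.\<close>

definition outer_comp :: "'a \<Rightarrow> nat \<Rightarrow> 'a \<Rightarrow> 'a set" where
  "outer_comp c \<rho> a = walk_in (outer c \<rho>) `` {a}"

lemma walk_in_mono: "Y \<subseteq> Z \<Longrightarrow> walk_in Y \<subseteq> walk_in Z"
  unfolding walk_in_def by (intro rtrancl_mono) auto

lemma walk_in_sym: "(x, y) \<in> walk_in Y \<Longrightarrow> (y, x) \<in> walk_in Y"
proof -
  have "sym (walk_in Y)" unfolding walk_in_def using sym_edges by (intro sym_rtrancl) (auto simp: sym_def)
  then show "(x, y) \<in> walk_in Y \<Longrightarrow> (y, x) \<in> walk_in Y" by (rule symD)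
qed

lemma walk_in_refl: "(x, x) \<in> walk_in Y"
  by (simp add: walk_in_def)

lemma walk_in_trans: "(x, y) \<in> walk_in Y \<Longrightarrow> (y, z) \<in> walk_in Y \<Longrightarrow> (x, z) \<in> walk_in Y"
  unfolding walk_in_def by (rule rtrancl_trans)

lemma walk_in_edge: "(x, y) \<in> edges \<Longrightarrow> x \<in> Y \<Longrightarrow> y \<in> Y \<Longrightarrow> (x, y) \<in> walk_in Y"
  by (auto simp: walk_in_def)

lemma walk_in_invariant:
  assumes "(x, y) \<in> walk_in Y" "P x" "\<And>u v. (u, v) \<in> edges \<Longrightarrow> u \<in> Y \<Longrightarrow> v \<in> Y \<Longrightarrow> P u \<Longrightarrow> P v"
  shows "P y"
  using assms(1) unfolding walk_in_def
  by (induction rule: rtrancl_induct) (use assms(2,3) in auto)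

lemma outer_comp_self: "a \<in> outer_comp c \<rho> a"
  by (simp add: outer_comp_def walk_in_refl)

lemma outer_comp_subset: "a \<in> outer c \<rho> \<Longrightarrow> outer_comp c \<rho> a \<subseteq> outer c \<rho>"
  unfolding outer_comp_def by (auto elim: walk_in_invariant)

lemma outer_comp_step:
  assumes "x \<in> outer_comp c \<rho> a" "a \<in> outer c \<rho>" "(x, y) \<in> edges" "y \<in> outer c \<rho>"
  shows "y \<in> outer_comp c \<rho> a"
  using outer_comp_subset[OF assms(2)] assms walk_in_edge[OF assms(3), of "outer c \<rho>"] walk_in_trans
  unfolding outer_comp_def by blast

lemma outer_comp_eq: "x \<in> outer_comp c \<rho> a \<Longrightarrow> outer_comp c \<rho> x = outer_comp c \<rho> a"
  unfolding outer_comp_def using walk_in_sym walk_in_trans by blast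

lemma outer_comp_walk:
  assumes "a \<in> outer c \<rho>" "x \<in> outer_comp c \<rho> a"
  shows "(a, x) \<in> walk_in (outer_comp c \<rho> a)"
proof -
  have "(a, x) \<in> walk_in (outer c \<rho>)" using assms(2) by (simp add: outer_comp_def)
  then have "x \<in> outer_comp c \<rho> a \<and> (a, x) \<in> walk_in (outer_comp c \<rho> a)"
  proof (rule walk_in_invariant)
    fix u v assume uv: "(u, v) \<in> edges" "u \<in> outer c \<rho>" "v \<in> outer c \<rho>"
      "u \<in> outer_comp c \<rho> a \<and> (a, u) \<in> walk_in (outer_comp c \<rho> a)"
    then have "v \<in> outer_comp c \<rho> a" using outer_comp_step assms(1) by blast
    with uv show "v \<in> outer_comp c \<rho> a \<and> (a, v) \<in> walk_in (outer_comp c \<rho> a)"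
      using walk_in_edge walk_in_trans by blast
  qed (simp add: outer_comp_self walk_in_refl)
  then show ?thesis by blast
qed

lemma outer_comp_exit:
  assumes "a \<in> outer c \<rho>" "x \<in> outer_comp c \<rho> a" "(x, y) \<in> edges" "y \<notin> outer_comp c \<rho> a"
  shows "y \<in> carrier G" "gdist c y \<le> \<rho>"
proof -
  show "y \<in> carrier G" using edges_carrier[OF assms(3)] by simp
  moreover have "y \<notin> outer c \<rho>" using outer_comp_step[OF assms(2,1,3)] assms(4) by blast
  ultimately show "gdist c y \<le> \<rho>" by (simp add: outer_def)
qed

text \<open>The complement of a component is connected, as a geodesic to the center \<open>c\<close> never enters the component:
  up to its first vertex in the component it would have stayed outside of the ball.\<close>

lemma complement_walk:
  assumes c: "c \<in> carrier G" and a: "a \<in> outer c \<rho>" and "x \<in> carrier G - outer_comp c \<rho> a"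
  shows "(c, x) \<in> walk_in (carrier G - outer_comp c \<rho> a)"
  using assms(3)
proof (induction "gdist c x" arbitrary: x)
  case 0
  then show ?case using gdist_0_iff[OF c, of x] by (auto simp: walk_in_refl)
next
  case (Suc m)
  then obtain p where p: "(p, x) \<in> edges" "gdist c p = m"
    using gdist_parent[OF c, of x m] by (metis DiffD1)
  have "p \<notin> outer_comp c \<rho> a"
  proof
    assume pc: "p \<in> outer_comp c \<rho> a"
    then have "\<rho> < gdist c p" using outer_comp_subset[OF a] by (auto simp: outer_def)
    then have "x \<in> outer c \<rho>" using p Suc by (auto simp: outer_def)
    from outer_comp_step[OF pc a p(1) this] Suc.prems show False by simp
  qed
  then have "p \<in> carrier G - outer_comp c \<rho> a" using edges_carrier[OF p(1)] by simp
  with Suc.hyps(1)[of p] p Suc.prems show ?case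
    using walk_in_edge[OF p(1)] walk_in_trans by blast
qed

text \<open>An element that leaves \<open>A\<close> under a product of generators leaves it at some prefix of the product, and
  right translations are injective.\<close>

lemma finite_right_boundary:
  assumes A: "A \<subseteq> carrier G" and fin: "\<And>t. t \<in> gens \<Longrightarrow> finite {x \<in> A. x \<otimes> t \<notin> A}" and g: "g \<in> carrier G"
  shows "finite {x \<in> A. x \<otimes> g \<notin> A}"
proof -
  have "(\<one>, g) \<in> edges\<^sup>*" using g by (intro reach) auto
  then show ?thesis
  proof (induction rule: rtrancl_induct)
    case base
    have "{x \<in> A. x \<otimes> \<one> \<notin> A} = {}" using A by auto
    then show ?case by (simp only: finite.emptyI)
  next
    case (step g g')
    then obtain t where t: "g \<in> carrier G" "t \<in> gens" "t \<in> carrier G" "g' = g \<otimes> t"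
      using gens_subset by (auto simp: edges_def)
    let ?Z = "{x \<in> carrier G. x \<otimes> g \<in> {y \<in> A. y \<otimes> t \<notin> A}}"
    have "inj_on (\<lambda>x. x \<otimes> g) ?Z" using t by (auto simp: inj_on_def)
    then have "finite ?Z" by (rule inj_on_finite[OF _ _ fin[OF t(2)]]) auto
    moreover have "{x \<in> A. x \<otimes> g' \<notin> A} \<subseteq> {x \<in> A. x \<otimes> g \<notin> A} \<union> ?Z"
      using A t by (auto simp: m_assoc)
    ultimately show ?case using step.IH by (meson finite_UnI finite_subset)
  qed
qed

text \<open>Elements that leave the component under a generator are at distance at most \<open>\<rho> + 1\<close> from \<open>c\<close>.\<close>

lemma outer_comp_finite_or_cofinite:
  assumes "one_end_property G" and c: "c \<in> carrier G" and a: "a \<in> outer c \<rho>"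
  shows "finite (outer_comp c \<rho> a) \<or> finite (carrier G - outer_comp c \<rho> a)"
proof -
  have sub: "outer_comp c \<rho> a \<subseteq> carrier G" using outer_comp_subset[OF a] by (auto simp: outer_def)
  have "finite {x \<in> outer_comp c \<rho> a. x \<otimes> t \<notin> outer_comp c \<rho> a}" if "t \<in> gens" for t
  proof (rule finite_subset[OF _ finite_ball[OF c, of "\<rho> + 1"]], clarify)
    fix x assume x: "x \<in> outer_comp c \<rho> a" "x \<otimes> t \<notin> outer_comp c \<rho> a"
    then have e: "(x, x \<otimes> t) \<in> edges" using sub that by (auto simp: edges_def)
    from outer_comp_exit[OF a x(1) e x(2)] gdist_edge_le[OF c edges_sym[OF e]] sub x
    show "x \<in> carrier G \<and> gdist c x \<le> \<rho> + 1" by auto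
  qed
  from finite_right_boundary[OF sub this] assms(1) sub show ?thesis
    unfolding one_end_property_def by blast
qed

text \<open>Suppose that the component \<open>U\<close> of \<open>a\<close> is finite. The ball of radius \<open>\<rho>\<close> around \<open>a\<close> is disjoint from
  the one around \<open>c\<close>, and connected, so it lies in \<open>U\<close>. The left translation that takes \<open>c\<close> to \<open>a\<close> takes \<open>U\<close> to a
  component \<open>V\<close> of the complement of the ball around \<open>a\<close>. The complement of \<open>U\<close> is connected, infinite and
  disjoint from that ball, so it cannot meet the finite component \<open>V\<close>. Thus \<open>V\<close> is contained in \<open>U\<close>, even
  without the point \<open>a\<close>, although both have the same number of elements.\<close>

lemma deep_outer_comp_infinite:
  assumes inf: "infinite (carrier G)" and c: "c \<in> carrier G" and a: "a \<in> carrier G" "2 * \<rho> < gdist c a"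
  shows "infinite (outer_comp c \<rho> a)"
proof
  define U where "U = outer_comp c \<rho> a"
  assume "finite (outer_comp c \<rho> a)"
  then have fin: "finite U" by (simp add: U_def)
  have ao: "a \<in> outer c \<rho>" using a by (auto simp: outer_def)
  have UG: "U \<subseteq> carrier G" using outer_comp_subset[OF ao] by (auto simp: outer_def U_def)
  have ball: "x \<in> U" if "x \<in> carrier G" "gdist a x \<le> \<rho>" for x
    using that
  proof (induction "gdist a x" arbitrary: x)
    case 0
    then show ?case using gdist_0_iff[OF a(1), of x] outer_comp_self by (auto simp: U_def)
  next
    case (Suc m)
    then obtain p where p: "(p, x) \<in> edges" "gdist a p = m" using gdist_parent[OF a(1), of x m] by metis
    have "p \<in> U" using Suc p edges_carrier[OF p(1)] by auto
    moreover have "gdist c a \<le> gdist c x + gdist x a" using c a Suc by (intro gdist_triangle) auto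
    then have "x \<in> outer c \<rho>" using Suc.prems a gdist_sym[of x a] by (auto simp: outer_def)
    ultimately show ?case using outer_comp_step[OF _ ao p(1)] by (simp add: U_def)
  qed
  define g where "g = a \<otimes> inv c"
  have g: "g \<in> carrier G" "g \<otimes> c = a" using a c by (auto simp: g_def m_assoc)
  have gdist_g: "gdist a (g \<otimes> x) = gdist c x" if "x \<in> carrier G" for x
    using gdist_translate[OF g(1) c that] g(2) by simp
  let ?V = "(\<lambda>x. g \<otimes> x) ` U"
  have closed: "z \<in> ?V" if y: "y \<in> ?V" and that: "(y, z) \<in> edges" "z \<in> outer a \<rho>" for y z
  proof -
    from y obtain x where x: "x \<in> U" "y = g \<otimes> x" by blast
    have zG: "z \<in> carrier G" using that(2) by (simp add: outer_def)
    have xG: "x \<in> carrier G" using x UG by blast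
    have "(inv g \<otimes> y, inv g \<otimes> z) \<in> edges" using that(1) g(1) by (intro edges_translate) auto
    moreover have "inv g \<otimes> y = x" using x xG g(1) by (simp add: m_assoc[symmetric])
    ultimately have e: "(x, inv g \<otimes> z) \<in> edges" by simp
    have gz: "g \<otimes> (inv g \<otimes> z) = z" using g(1) zG by (simp add: m_assoc[symmetric])
    then have "gdist c (inv g \<otimes> z) = gdist a z" using gdist_g[of "inv g \<otimes> z"] g(1) zG by simp
    then have "inv g \<otimes> z \<in> outer c \<rho>" using that(2) zG g(1) by (simp add: outer_def)
    then have "inv g \<otimes> z \<in> U" using outer_comp_step[OF _ ao e] x(1) by (simp add: U_def)
    then show "z \<in> ?V" using gz by force
  qed
  have "?V \<subseteq> U"
  proof (rule ccontr)
    assume "\<not> ?V \<subseteq> U"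
    then obtain y where y: "y \<in> ?V" "y \<notin> U" by blast
    then have yG: "y \<in> carrier G - U" using UG g(1) by auto
    have "carrier G - U \<subseteq> ?V"
    proof
      fix x assume x: "x \<in> carrier G - U"
      have "(y, x) \<in> walk_in (carrier G - U)"
        using x yG unfolding U_def
        by (blast intro: walk_in_trans[OF walk_in_sym[OF complement_walk[OF c ao]] complement_walk[OF c ao]])
      then show "x \<in> ?V"
      proof (rule walk_in_invariant)
        fix u v assume uv: "(u, v) \<in> edges" "v \<in> carrier G - U" "u \<in> ?V"
        have "\<rho> < gdist a v" using ball[of v] uv(2) by (meson DiffD1 DiffD2 not_less)
        then show "v \<in> ?V" using uv by (intro closed[OF uv(3,1)]) (simp add: outer_def)
      qed (rule y(1))
    qed
    then have "finite (carrier G - U)" using fin finite_subset by blast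
    with fin inf show False by simp
  qed
  moreover have "a \<in> U" "a \<notin> ?V"
    using outer_comp_self gdist_g UG outer_comp_subset[OF ao] by (auto simp: U_def outer_def)
      (metis (no_types, lifting) gdist_refl mem_Collect_eq not_less_zero outer_def subsetD)
  ultimately have "card ?V < card U" using fin by (intro psubset_card_mono) auto
  moreover have "card ?V = card U" using g(1) UG by (intro card_image inj_onI) (metis Units_eq Units_l_cancel subsetD)
  ultimately show False by simp
qed

text \<open>Following a geodesic towards \<open>c\<close> until just before it leaves the component, the distance from \<open>c\<close>
  only decreases.\<close>

lemma outer_comp_descend:
  assumes c: "c \<in> carrier G" and a: "a \<in> outer c \<rho>" and "x \<in> outer_comp c \<rho> a" "gdist c x \<le> m"
  obtains x' v where "(x, x') \<in> walk_in {v \<in> carrier G. \<rho> < gdist c v \<and> gdist c v \<le> m}"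
    "x' \<in> outer_comp c \<rho> a" "(x', v) \<in> edges" "v \<in> carrier G - outer_comp c \<rho> a"
proof -
  let ?Y = "{v \<in> carrier G. \<rho> < gdist c v \<and> gdist c v \<le> m}"
  have "\<exists>x' v. (x, x') \<in> walk_in ?Y \<and> x' \<in> outer_comp c \<rho> a \<and> (x', v) \<in> edges \<and> v \<in> carrier G - outer_comp c \<rho> a"
    using assms(3,4)
  proof (induction "gdist c x" arbitrary: x)
    case 0
    then show ?case using outer_comp_subset[OF a] by (auto simp: outer_def)
  next
    case (Suc k)
    have x: "x \<in> carrier G" "\<rho> < gdist c x" using outer_comp_subset[OF a] Suc.prems by (auto simp: outer_def)
    obtain p where p: "(p, x) \<in> edges" "gdist c p = k" using gdist_parent[OF c x(1)] Suc.hyps(2) by metis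
    have pG: "p \<in> carrier G" using edges_carrier[OF p(1)] by simp
    show ?case
    proof (cases "p \<in> outer_comp c \<rho> a")
      case True
      then have "\<rho> < gdist c p" using outer_comp_subset[OF a] by (auto simp: outer_def)
      then have "(x, p) \<in> walk_in ?Y"
        using p x pG Suc.hyps(2) Suc.prems(2) by (intro walk_in_edge[OF edges_sym]) auto
      moreover have "\<exists>x' v. (p, x') \<in> walk_in ?Y \<and> x' \<in> outer_comp c \<rho> a \<and> (x', v) \<in> edges \<and> v \<in> carrier G - outer_comp c \<rho> a"
        using Suc.hyps p True Suc.prems(2) by auto
      ultimately show ?thesis using walk_in_trans by blast
    next
      case False
      then show ?thesis using edges_sym[OF p(1)] pG Suc.prems walk_in_refl by blast
    qed
  qed
  with that show thesis by blast
qed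

text \<open>A geodesic from \<open>x\<close> to \<open>v\<close> has to leave the component, and does so through the ball.\<close>

lemma outer_comp_near_exit:
  assumes c: "c \<in> carrier G" and a: "a \<in> outer c \<rho>" and x: "x \<in> outer_comp c \<rho> a" and v: "v \<in> carrier G - outer_comp c \<rho> a"
  shows "gdist c x \<le> \<rho> + gdist x v"
proof -
  have xG: "x \<in> carrier G" using outer_comp_subset[OF a] x by (auto simp: outer_def)
  have "gdist c x \<le> \<rho> + n" if "(x, v) \<in> edges ^^ n" "v \<notin> outer_comp c \<rho> a" for n v
    using that
  proof (induction n arbitrary: v)
    case (Suc n)
    then obtain w where w: "(x, w) \<in> edges ^^ n" "(w, v) \<in> edges" by auto
    show ?case
    proof (cases "w \<in> outer_comp c \<rho> a")
      case True
      from outer_comp_exit[OF a True w(2) Suc.prems(2)] have v: "v \<in> carrier G" "gdist c v \<le> \<rho>" .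
      have "gdist c x \<le> gdist c v + gdist v x" using c v xG by (intro gdist_triangle) auto
      also have "gdist v x \<le> Suc n" using gdist_le[OF edges_pow_sym[OF Suc.prems(1)]] .
      finally show ?thesis using v by simp
    next
      case False
      from Suc.IH[OF w(1) False] show ?thesis by simp
    qed
  qed (use x in auto)
  from this[OF gdist_pow] v xG show ?thesis by auto
qed

lemma geodesic_walk:
  assumes "u \<in> carrier G" "(u, v) \<in> edges ^^ n"
  shows "(u, v) \<in> walk_in {z \<in> carrier G. gdist u z \<le> n}"
  using assms(2)
proof (induction n arbitrary: v)
  case 0
  then show ?case by (simp add: walk_in_refl)
next
  case (Suc n)
  then obtain w where w: "(u, w) \<in> edges ^^ n" "(w, v) \<in> edges" by auto
  have "(u, w) \<in> walk_in {z \<in> carrier G. gdist u z \<le> Suc n}"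
    using Suc.IH[OF w(1)] by (rule subsetD[OF walk_in_mono, rotated]) auto
  moreover have "(w, v) \<in> walk_in {z \<in> carrier G. gdist u z \<le> Suc n}"
    using gdist_le[OF w(1)] gdist_le[OF Suc.prems] edges_carrier[OF w(2)] by (intro walk_in_edge w(2)) auto
  ultimately show ?case by (rule walk_in_trans)
qed

text \<open>Let \<open>Q\<close> be the set of those boundary vertices of \<open>U\<close> that can be reached from \<open>x\<close> by jumps of length at
  most \<open>D\<close> along the boundary. The crossings of the boundary with inner end in \<open>Q\<close> define a local cocycle: in
  a triangle of diameter at most \<open>D\<close> that crosses the boundary, two sides are crossings, and their inner ends
  are equal or one jump apart. Its potential \<open>h\<close> is constant on \<open>U\<close> and on the complement of \<open>U\<close>, both being
  connected. The two values differ because of the crossing at \<open>x\<close>, so the crossing at \<open>y\<close> is counted as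
  well.\<close>

lemma boundary_linked:
  assumes h1: "H1_trivial_at D"
    and D: "1 \<le> D" and c: "c \<in> carrier G" and a: "a \<in> outer c \<rho>"
    and U: "U = outer_comp c \<rho> a"
    and bd: "bd = {x \<in> U. \<exists>v\<in>carrier G - U. gdist x v \<le> D}"
    and xv: "x \<in> U" "(x, v) \<in> edges" "v \<in> carrier G - U"
    and yw: "y \<in> U" "(y, w) \<in> edges" "w \<in> carrier G - U"
  shows "(x, y) \<in> {(p, q). p \<in> bd \<and> q \<in> bd \<and> gdist p q \<le> D}\<^sup>*"
proof -
  let ?L = "{(p, q). p \<in> bd \<and> q \<in> bd \<and> gdist p q \<le> D}"
  define Q where "Q = ?L\<^sup>* `` {x}"
  define f where "f u v = ((u \<in> U \<and> v \<notin> U \<and> u \<in> Q) \<or> (v \<in> U \<and> u \<notin> U \<and> v \<in> Q))" for u v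
  have UG: "U \<subseteq> carrier G" using outer_comp_subset[OF a] by (auto simp: outer_def U)
  have grow: "q \<in> Q" if "p \<in> Q" "p \<in> bd" "q \<in> bd" "gdist p q \<le> D" for p q
    using that unfolding Q_def by (auto intro: rtrancl_into_rtrancl)
  \<comment> \<open>The case of a triangle with two vertices in \<open>U\<close>.\<close>
  have key: "p \<in> Q \<longleftrightarrow> q \<in> Q"
    if "p \<in> U" "q \<in> U" "z \<in> carrier G" "z \<notin> U" "gdist p q \<le> D" "gdist p z \<le> D" "gdist q z \<le> D" for p q z
  proof -
    have "p \<in> bd" "q \<in> bd" using that by (auto simp: bd)
    moreover have "gdist q p = gdist p q" using that UG by (intro gdist_sym) auto
    then have "gdist q p \<le> D" using that by simp
    ultimately show ?thesis using grow that(5) by blast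
  qed
  have "local_cocycle D f"
    unfolding local_cocycle_def
  proof (intro ballI impI)
    fix p q r assume G: "p \<in> carrier G" "q \<in> carrier G" "r \<in> carrier G"
      and le: "gdist p q \<le> D" "gdist q r \<le> D" "gdist p r \<le> D"
    have le': "gdist q p \<le> D" "gdist r q \<le> D" "gdist r p \<le> D" using le gdist_sym G by metis+
    show "f p r = (f p q \<noteq> f q r)"
      using key[of p q r] key[of q r p] key[of p r q] G le le'
      by (cases "p \<in> U"; cases "q \<in> U"; cases "r \<in> U") (auto simp: f_def)
  qed
  with h1 obtain h :: "'a \<Rightarrow> bool" where h: "\<And>u v. (u, v) \<in> edges \<Longrightarrow> f u v \<longleftrightarrow> h u \<noteq> h v"
    unfolding H1_trivial_at_def by metis
  have h_U: "h z = h a" if "z \<in> U" for z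
  proof -
    have "(a, z) \<in> walk_in U" using outer_comp_walk[OF a] that by (simp add: U)
    then show ?thesis
    proof (rule walk_in_invariant)
      fix u v assume "(u, v) \<in> edges" "u \<in> U" "v \<in> U" "h u = h a"
      then show "h v = h a" using h[of u v] by (auto simp: f_def)
    qed simp
  qed
  have h_c: "h z = h c" if "z \<in> carrier G - U" for z
  proof -
    have "(c, z) \<in> walk_in (carrier G - U)" using complement_walk[OF c a] that by (simp add: U)
    then show ?thesis
    proof (rule walk_in_invariant)
      fix u v assume "(u, v) \<in> edges" "u \<in> carrier G - U" "v \<in> carrier G - U" "h u = h c"
      then show "h v = h c" using h[of u v] by (auto simp: f_def)
    qed simp
  qed
  have "x \<in> Q" by (simp add: Q_def)
  then have "f x v" using xv by (simp add: f_def)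
  then have "h a \<noteq> h c" using h[OF xv(2)] h_U[OF xv(1)] h_c[OF xv(3)] by simp
  then have "f y w" using h[OF yw(2)] h_U[OF yw(1)] h_c[OF yw(3)] by simp
  then have "y \<in> Q" using yw by (auto simp: f_def)
  then show ?thesis by (simp add: Q_def)
qed

text \<open>From \<open>a\<close> and from \<open>b\<close> the walk descends to the boundary of their common component outside of the ball of
  radius \<open>\<rho>\<close>. There it proceeds by jumps between boundary vertices, each replaced by a geodesic of length
  at most \<open>D\<close>; since boundary vertices are at distance between \<open>\<rho>\<close> and \<open>\<rho> + D\<close> from \<open>c\<close>, these geodesics stay
  between \<open>\<rho> - D\<close> and \<open>\<rho> + 2D\<close>.\<close>

lemma annulus_walk:
  assumes h1: "H1_trivial_at D"
    and D: "1 \<le> D" and inf: "infinite (carrier G)" and ends: "one_end_property G"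
    and c: "c \<in> carrier G" and a: "a \<in> carrier G" "2 * \<rho> < gdist c a" and b: "b \<in> carrier G" "2 * \<rho> < gdist c b"
    and m: "gdist c a \<le> m" "gdist c b \<le> m" "\<rho> + 2 * D \<le> m"
  shows "(a, b) \<in> walk_in {v \<in> carrier G. \<rho> < gdist c v + D \<and> gdist c v \<le> m}" (is "_ \<in> walk_in ?Y")
proof -
  have ao: "a \<in> outer c \<rho>" and bo: "b \<in> outer c \<rho>" using a b by (auto simp: outer_def)
  define U where "U = outer_comp c \<rho> a"
  have UG: "U \<subseteq> carrier G" using outer_comp_subset[OF ao] by (auto simp: outer_def U_def)
  have "finite (carrier G - outer_comp c \<rho> a)" "finite (carrier G - outer_comp c \<rho> b)"
    using outer_comp_finite_or_cofinite[OF ends c] deep_outer_comp_infinite[OF inf c] a b ao bo by blast+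
  then have "finite ((carrier G - outer_comp c \<rho> a) \<union> (carrier G - outer_comp c \<rho> b))" by simp
  then obtain z where "z \<in> outer_comp c \<rho> a" "z \<in> outer_comp c \<rho> b"
    using inf finite_subset[of "carrier G" "(carrier G - outer_comp c \<rho> a) \<union> (carrier G - outer_comp c \<rho> b)"] by blast
  then have "b \<in> U" using outer_comp_eq outer_comp_self unfolding U_def by metis
  have "a \<in> U" by (simp add: U_def outer_comp_self)
  let ?Z = "{v \<in> carrier G. \<rho> < gdist c v \<and> gdist c v \<le> m}"
  have ZY: "?Z \<subseteq> ?Y" by auto
  obtain x v where x: "(a, x) \<in> walk_in ?Z" "x \<in> U" "(x, v) \<in> edges" "v \<in> carrier G - U"
    unfolding U_def by (rule outer_comp_descend[OF c ao \<open>a \<in> U\<close>[unfolded U_def] m(1)])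
  obtain y w where y: "(b, y) \<in> walk_in ?Z" "y \<in> U" "(y, w) \<in> edges" "w \<in> carrier G - U"
    unfolding U_def by (rule outer_comp_descend[OF c ao \<open>b \<in> U\<close>[unfolded U_def] m(2)])
  define bd where "bd = {x \<in> U. \<exists>v\<in>carrier G - U. gdist x v \<le> D}"
  have step: "(p, q) \<in> walk_in ?Y" if "p \<in> bd" "q \<in> bd" "gdist p q \<le> D" for p q
  proof -
    have pq: "p \<in> carrier G" "q \<in> carrier G" using that UG by (auto simp: bd_def)
    have "\<rho> < gdist c p" using that(1) outer_comp_subset[OF ao] by (auto simp: bd_def U_def outer_def)
    moreover obtain u where "u \<in> carrier G - U" "gdist p u \<le> D"
      using \<open>p \<in> bd\<close> unfolding bd_def by blast
    then have "gdist c p \<le> \<rho> + D" using outer_comp_near_exit[OF c ao, of p u] that(1) by (auto simp: bd_def U_def)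
    ultimately have "{z \<in> carrier G. gdist p z \<le> gdist p q} \<subseteq> ?Y"
    proof (intro subsetI)
      fix z assume z: "z \<in> {z \<in> carrier G. gdist p z \<le> gdist p q}"
      assume "\<rho> < gdist c p" "gdist c p \<le> \<rho> + D"
      moreover have "gdist c z \<le> gdist c p + gdist p z" "gdist c p \<le> gdist c z + gdist z p" "gdist z p = gdist p z"
        using z pq c by (auto intro: gdist_triangle gdist_sym)
      ultimately show "z \<in> ?Y" using z that(3) m(3) by auto
    qed
    with geodesic_walk[OF pq(1) gdist_pow[OF pq]] walk_in_mono show ?thesis by blast
  qed
  have "(x, y) \<in> {(p, q). p \<in> bd \<and> q \<in> bd \<and> gdist p q \<le> D}\<^sup>*"
    by (rule boundary_linked[OF h1 D c ao U_def bd_def x(2-4) y(2-4)])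
  then have "(x, y) \<in> walk_in ?Y"
  proof (induction rule: rtrancl_induct)
    case (step q r)
    then show ?case using \<open>\<And>q p. \<lbrakk>p \<in> bd; q \<in> bd; gdist p q \<le> D\<rbrakk> \<Longrightarrow> (p, q) \<in> walk_in ?Y\<close> walk_in_trans by blast
  qed (rule walk_in_refl)
  with x(1) y(1) walk_in_mono[OF ZY] walk_in_sym walk_in_trans show ?thesis by (meson subsetD)
qed

end

section \<open>The exponential bound\<close>

lemma preceq_trans:
  assumes "f \<preceq> g" "g \<preceq> h" "mono h"
  shows "f \<preceq> h"
proof -
  obtain A where A: "A > 0" "\<And>n. n \<ge> 0 \<Longrightarrow> f n \<le> ennreal A * g (A * n + A) + ennreal (A * n + A)"
    using assms(1) unfolding preceq_def by blast
  obtain B where B: "B > 0" "\<And>n. n \<ge> 0 \<Longrightarrow> g n \<le> ennreal B * h (B * n + B) + ennreal (B * n + B)"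
    using assms(2) unfolding preceq_def by blast
  \<comment> \<open>Large enough for the linear functions \<open>B k + B\<close> and \<open>A (B k + B) + k\<close> with \<open>k = A n + A\<close>, and for \<open>A B\<close>.\<close>
  define C where "C = A * B * (A + 1) + A * B + A * (A + 1) + B * (A + 1) + A"
  have pos: "0 < A * B" "0 < A * A * B" using A(1) B(1) by simp_all
  have "C > 0" using A(1) B(1) by (simp add: C_def add_pos_pos)
  moreover have "f n \<le> ennreal C * h (C * n + C) + ennreal (C * n + C)" if n: "n \<ge> 0" for n
  proof -
    define k where "k = A * n + A"
    have k: "0 \<le> k" using A(1) n by (simp add: k_def)
    have "B * k + B \<le> C * n + C"
      unfolding C_def k_def using A(1) B(1) n by (simp add: algebra_simps)
    then have h: "h (B * k + B) \<le> h (C * n + C)" using assms(3) by (simp add: monoD)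
    have "f n \<le> ennreal A * g k + ennreal k" using A(2)[OF n] by (simp add: k_def)
    also have "\<dots> \<le> ennreal A * (ennreal B * h (C * n + C) + ennreal (B * k + B)) + ennreal k"
      by (intro add_mono mult_left_mono order_trans[OF B(2)[OF k]] h) auto
    also have "\<dots> = ennreal (A * B) * h (C * n + C) + ennreal (A * (B * k + B) + k)"
    proof -
      have "ennreal A * ennreal (B * k + B) + ennreal k = ennreal (A * (B * k + B) + k)"
        using A(1) B(1) k by (subst ennreal_plus) (simp_all add: ennreal_mult')
      moreover have "ennreal A * (ennreal B * h (C * n + C)) = ennreal (A * B) * h (C * n + C)"
        using A(1) by (simp add: ennreal_mult' mult.assoc)
      ultimately show ?thesis by (simp only: distrib_left add.assoc)
    qed
    also have "\<dots> \<le> ennreal C * h (C * n + C) + ennreal (C * n + C)"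
    proof (rule add_mono[OF mult_right_mono[OF ennreal_leI] ennreal_leI])
      show "A * B \<le> C" using A(1) B(1) by (simp add: C_def algebra_simps)
      show "A * (B * k + B) + k \<le> C * n + C"
        unfolding C_def k_def using A(1) B(1) n by (simp add: algebra_simps)
    qed auto
    finally show ?thesis .
  qed
  ultimately show ?thesis unfolding preceq_def by blast
qed

context cayley_graph
begin

text \<open>A shortest walk does not use an edge twice, and the edges in \<open>Y\<close> are pairs of points of the ball.\<close>

lemma short_walk:
  assumes c: "c \<in> carrier G" and walk: "(a, b) \<in> walk_in Y" and Y: "Y \<subseteq> {v \<in> carrier G. gdist c v \<le> m}"
  obtains k where "(a, b) \<in> (edges \<inter> Y \<times> Y) ^^ k" "k \<le> (card gens + 1) ^ (2 * m)"
proof -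
  have finY: "finite Y" using finite_subset[OF Y finite_ball[OF c]] .
  have "card Y \<le> (card gens + 1) ^ m"
    using card_mono[OF finite_ball[OF c] Y] card_ball[OF c, of m] by linarith
  then have "card Y * card Y \<le> (card gens + 1) ^ m * (card gens + 1) ^ m" by (rule mult_le_mono) fact
  then have "card (Y \<times> Y) \<le> (card gens + 1) ^ (2 * m)"
    by (simp add: card_cartesian_product power_add[symmetric] mult_2)
  moreover have "card (edges \<inter> Y \<times> Y) \<le> card (Y \<times> Y)" using finY by (intro card_mono) auto
  ultimately have card: "card (edges \<inter> Y \<times> Y) \<le> (card gens + 1) ^ (2 * m)" by linarith
  have "finite (edges \<inter> Y \<times> Y)" using finY by blast
  with walk obtain k where "k \<le> card (edges \<inter> Y \<times> Y)" "(a, b) \<in> (edges \<inter> Y \<times> Y) ^^ k"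
    unfolding walk_in_def by (auto simp: rtrancl_finite_eq_relpow)
  with card that show thesis by (meson order_trans)
qed

text \<open>The constant 4 in the bound for \<open>\<gamma>\<close> absorbs the passage to vertices at distance at most 1 from the given
  points, the points inside of the edges of the walk, and the rounding of \<open>\<delta>r\<close> to an integer; the summand \<open>D\<close>
  makes up for the excursion of the walk into the ball of radius \<open>\<rho>\<close>.\<close>

lemma div3_exponential:
  assumes h1: "H1_trivial_at D"
    and D: "1 \<le> D" and inf: "infinite (carrier G)" and ends: "one_end_property G"
    and \<delta>: "0 < \<delta>" "\<delta> \<le> 1/4" and \<gamma>: "real D + 4 \<le> \<gamma>"
    and abc: "a \<in> cayley_space G S" "b \<in> cayley_space G S" "c \<in> cayley_space G S"
    and n: "cayley_dist G S a b \<le> n"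
    and m: "3 * n + 2 * real D + 2 \<le> real m"
  shows "X.div3 \<gamma> a b c \<delta> \<le> ennreal (n + 4 + real (card gens + 1) ^ (2 * m))"
proof -
  let ?d = "cayley_dist G S"
  define r where "r = min (?d c a) (?d c b)"
  obtain a0 where a0: "a0 \<in> carrier G" "X.joined UNIV 1 a (vtx a0)" by (rule near_vertex[OF abc(1)])
  obtain b0 where b0: "b0 \<in> carrier G" "X.joined UNIV 1 b (vtx b0)" by (rule near_vertex[OF abc(2)])
  obtain c0 where c0: "c0 \<in> carrier G" "X.joined UNIV 1 c (vtx c0)" by (rule near_vertex[OF abc(3)])
  note V = vtx_in_space[OF a0(1)] vtx_in_space[OF b0(1)] vtx_in_space[OF c0(1)]
  note d1 = joined_dist[OF a0(2)] joined_dist[OF b0(2)] joined_dist[OF c0(2)]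
  have n0: "0 \<le> n" using n X.nonneg[of a b] by linarith
  have r0: "0 \<le> r" by (simp add: r_def)
  have rn: "?d c a \<le> r + n" "?d c b \<le> r + n"
    using X.triangle[OF abc(3,1,2)] X.triangle[OF abc(3,2,1)] X.commute[of a b] n n0
    unfolding r_def min_def by (simp_all split: if_splits)
  have main: "X.div3 \<gamma> a b c \<delta> \<le> ennreal L" if "X.joined (- X.mball c (\<delta> * r - \<gamma>)) L a b" for L
    using X.div3_le_joined that by (simp add: r_def)
  have mono: "X.div3 \<gamma> a b c \<delta> \<le> ennreal (n + 4 + real (card gens + 1) ^ (2 * m))"
    if "X.div3 \<gamma> a b c \<delta> \<le> ennreal L" "L \<le> n + 4 + real (card gens + 1) ^ (2 * m)" for L
    using that(1) ennreal_leI[OF that(2)] by (rule order_trans)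
  show ?thesis
  proof (cases "\<delta> * r \<le> \<gamma> \<or> 2 * n \<le> r")
    case True
    define k where "k = gdist a0 b0"
    have "?d (vtx a0) (vtx b0) \<le> ?d (vtx a0) a + ?d a b + ?d b (vtx b0)"
      using X.triangle[of "vtx a0" a "vtx b0"] X.triangle[of a b "vtx b0"] V abc by simp
    then have k: "real k \<le> n + 2"
      using d1 n X.commute[of "vtx a0" a] dist_vtx[OF a0(1) b0(1)] by (simp add: k_def)
    have "X.joined UNIV (real k) (vtx a0) (vtx b0)"
      unfolding k_def by (rule joined_walk[OF gdist_pow[OF a0(1) b0(1)] subset_refl a0(1)]) auto
    from X.joined_trans[OF X.joined_trans[OF a0(2) this] X.joined_sym[OF b0(2)]]
    have "X.joined UNIV (n + 4) a b" by (rule X.joined_mono) (use k in simp)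
    then have "X.joined (- X.mball c (\<delta> * r - \<gamma>)) (n + 4) a b"
    proof (rule X.joined_near)
      fix z assume z: "z \<in> cayley_space G S" "?d a z \<le> n + 4"
      have "r \<le> ?d c z + (n + 4)"
        using X.triangle[OF abc(3) z(1) abc(1)] z(2) X.commute[of a z] by (auto simp: r_def)
      moreover have "\<delta> * r \<le> 1/4 * r" using \<delta> r0 by (intro mult_right_mono) auto
      ultimately have "\<delta> * r - \<gamma> \<le> ?d c z" using True
        by (elim disjE) (use \<gamma> r0 X.nonneg[of c z] in linarith)+
      then show "z \<in> - X.mball c (\<delta> * r - \<gamma>)" by auto
    qed
    then show ?thesis by (intro mono[OF main]) auto
  next
    case False
    \<comment> \<open>Now \<open>r\<close> exceeds 16 and is less than \<open>2n\<close>, and a ball of positive radius \<open>\<delta>r - \<gamma>\<close> has to be circumvented.\<close>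
    define \<rho> where "\<rho> = nat \<lfloor>\<delta> * r\<rfloor>"
    have dr: "\<gamma> < \<delta> * r" "r < 2 * n" using False by auto
    have dr4: "\<delta> * r \<le> 1/4 * r" using \<delta> r0 by (intro mult_right_mono) auto
    have r_big: "16 < r" using dr dr4 \<gamma> D by simp
    have \<rho>: "real \<rho> \<le> \<delta> * r" "\<delta> * r - 1 < real \<rho>"
      using dr(1) \<gamma> by (auto simp: \<rho>_def)
    have gdist_bound: "r - 2 \<le> real (gdist c0 u)" "real (gdist c0 u) \<le> r + n + 2"
      if "u \<in> carrier G" "x \<in> cayley_space G S" "?d x (vtx u) \<le> 1" "r \<le> ?d c x" "?d c x \<le> r + n" for u x
    proof -
      note U = vtx_in_space[OF that(1)]
      have "?d (vtx c0) (vtx u) \<le> ?d (vtx c0) c + ?d c x + ?d x (vtx u)"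
        using X.triangle[of "vtx c0" c "vtx u"] X.triangle[of c x "vtx u"] V U abc that by simp
      moreover have "?d c x \<le> ?d c (vtx c0) + ?d (vtx c0) (vtx u) + ?d (vtx u) x"
        using X.triangle[of c "vtx c0" x] X.triangle[of "vtx c0" "vtx u" x] V U abc that by simp
      ultimately show "r - 2 \<le> real (gdist c0 u)" "real (gdist c0 u) \<le> r + n + 2"
        using d1 that X.commute[of "vtx c0" c] X.commute[of "vtx u" x] dist_vtx[OF c0(1) that(1)] by auto
    qed
    have ga: "r - 2 \<le> real (gdist c0 a0)" "real (gdist c0 a0) \<le> r + n + 2"
      using gdist_bound[OF a0(1) abc(1) d1(1)] rn by (auto simp: r_def)
    have gb: "r - 2 \<le> real (gdist c0 b0)" "real (gdist c0 b0) \<le> r + n + 2"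
      using gdist_bound[OF b0(1) abc(2) d1(2)] rn by (auto simp: r_def)
    let ?Y = "{v \<in> carrier G. \<rho> < gdist c0 v + D \<and> gdist c0 v \<le> m}"
    have "(a0, b0) \<in> walk_in ?Y"
    proof (rule annulus_walk[OF h1 D inf ends c0(1) a0(1) _ b0(1)])
      have "real (2 * \<rho>) < r - 2" using \<rho>(1) dr4 r_big by linarith
      then show "2 * \<rho> < gdist c0 a0" "2 * \<rho> < gdist c0 b0" using ga(1) gb(1) by linarith+
      show "gdist c0 a0 \<le> m" "gdist c0 b0 \<le> m" "\<rho> + 2 * D \<le> m"
        using ga(2) gb(2) m dr(2) \<rho>(1) dr4 n0 by linarith+
    qed
    then obtain k where k: "(a0, b0) \<in> (edges \<inter> ?Y \<times> ?Y) ^^ k" "k \<le> (card gens + 1) ^ (2 * m)"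
      by (rule short_walk[OF c0(1)]) auto
    have far: "z \<in> - X.mball c (\<delta> * r - \<gamma>)"
      if z: "z \<in> cayley_space G S" "?d (vtx u) z \<le> 1" and u: "u \<in> carrier G" "\<rho> < gdist c0 u + D" for u z
    proof -
      have "?d (vtx c0) (vtx u) \<le> ?d (vtx c0) c + ?d c z + ?d z (vtx u)"
        using X.triangle[of "vtx c0" c "vtx u"] X.triangle[of c z "vtx u"] V vtx_in_space[OF u(1)] abc z by simp
      then have "real (gdist c0 u) \<le> ?d c z + 2"
        using d1 z X.commute[of "vtx c0" c] X.commute[of "vtx u" z] dist_vtx[OF c0(1) u(1)] by simp
      moreover have "real \<rho> < real (gdist c0 u) + real D" using u(2) by linarith
      ultimately have "\<delta> * r - \<gamma> \<le> ?d c z" using \<rho>(2) \<gamma> by linarith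
      then show ?thesis by auto
    qed
    have near: "X.joined (- X.mball c (\<delta> * r - \<gamma>)) 1 x (vtx u)"
      if "X.joined UNIV 1 x (vtx u)" "x \<in> cayley_space G S" "r \<le> ?d c x" for x u
    proof (rule X.joined_near[OF that(1)])
      fix z assume z: "z \<in> cayley_space G S" "?d x z \<le> 1"
      have "r \<le> ?d c z + 1"
        using X.triangle[OF abc(3) z(1) that(2)] z(2) X.commute[of x z] that(3) by simp
      then have "\<delta> * r - \<gamma> \<le> ?d c z" using dr4 \<gamma> r0 by linarith
      then show "z \<in> - X.mball c (\<delta> * r - \<gamma>)" by auto
    qed
    have "real \<rho> < r - 2" using \<rho>(1) dr4 r_big by linarith
    then have "\<rho> < gdist c0 a0 + D" using ga(1) by linarith
    have "X.joined (- X.mball c (\<delta> * r - \<gamma>)) (real k) (vtx a0) (vtx b0)"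
    proof (rule joined_walk[OF k(1) _ a0(1)])
      show "vtx a0 \<in> - X.mball c (\<delta> * r - \<gamma>)"
        using V(1) a0(1) \<open>\<rho> < gdist c0 a0 + D\<close> by (intro far[of _ a0]) auto
      show "z \<in> - X.mball c (\<delta> * r - \<gamma>)"
        if "(x, y) \<in> edges \<inter> ?Y \<times> ?Y" "z \<in> cayley_space G S" "?d (vtx x) z \<le> 1" for x y z
        using that by (intro far[of z x]) auto
    qed auto
    with near[OF a0(2) abc(1)] near[OF b0(2) abc(2)]
    have "X.joined (- X.mball c (\<delta> * r - \<gamma>)) (1 + real k + 1) a b"
      by (intro X.joined_trans[OF X.joined_trans X.joined_sym]) (auto simp: r_def)
    then show ?thesis
    proof (intro mono[OF main])
      have "real k \<le> real ((card gens + 1) ^ (2 * m))" using k(2) by (rule of_nat_mono)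
      then show "1 + real k + 1 \<le> n + 4 + real (card gens + 1) ^ (2 * m)" using n0 by simp
    qed
  qed
qed

text \<open>The radius \<open>m\<close> grows like \<open>3n\<close>, so the number of edges in the ball of that radius is at most the
  exponential of a linear function of \<open>n\<close>.\<close>

lemma Div_exponential:
  assumes h1: "H1_trivial_at D"
    and D: "1 \<le> D" and inf: "infinite (carrier G)" and ends: "one_end_property G"
    and \<delta>: "0 < \<delta>" "\<delta> \<le> 1/4" and \<gamma>: "real D + 4 \<le> \<gamma>"
  shows "X.Div \<gamma> \<delta> \<preceq> (\<lambda>n. ennreal (exp n))"
proof -
  define K where "K = real (card gens + 1)"
  have K: "1 \<le> K" by (simp add: K_def)
  define C where "C = (4 * real D + 12) * ln K + 4"
  have lnK: "0 \<le> ln K" using K by simp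
  have C: "4 \<le> C" using lnK by (simp add: C_def)
  have "X.Div \<gamma> \<delta> n \<le> ennreal C * ennreal (exp (C * n + C)) + ennreal (C * n + C)" if n: "0 \<le> n" for n
  proof -
    define m where "m = nat \<lceil>3 * n + 2 * real D + 2\<rceil>"
    have m: "3 * n + 2 * real D + 2 \<le> real m" "real m \<le> 3 * n + 2 * real D + 3"
      using n by (auto simp: m_def) linarith+
    have "X.Div \<gamma> \<delta> n \<le> ennreal (n + 4 + K ^ (2 * m))"
      unfolding X.Div_def K_def
      by (rule SUP_least, clarify) (rule div3_exponential[OF h1 D inf ends \<delta> \<gamma> _ _ _ _ m(1)])
    also have "\<dots> \<le> ennreal (C * exp (C * n + C) + (C * n + C))"
    proof (rule ennreal_leI)
      have "K ^ (2 * m) = exp (real (2 * m) * ln K)"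
        unfolding exp_of_nat_mult using K by simp
      also have "\<dots> \<le> exp (C * n + C)"
      proof -
        have "real (2 * m) * ln K \<le> (6 * n + (4 * real D + 6)) * ln K"
          using m(2) lnK by (intro mult_right_mono) auto
        also have "\<dots> = 6 * ln K * n + (4 * real D + 6) * ln K" by (simp add: algebra_simps)
        also have "\<dots> \<le> C * n + C"
          using lnK n by (intro add_mono mult_right_mono) (simp_all add: C_def algebra_simps)
        finally show ?thesis by simp
      qed
      also have "\<dots> \<le> C * exp (C * n + C)" using C by simp
      finally have "K ^ (2 * m) \<le> C * exp (C * n + C)" .
      moreover have "1 * n \<le> C * n" using C n by (intro mult_right_mono) auto
      ultimately show "n + 4 + K ^ (2 * m) \<le> C * exp (C * n + C) + (C * n + C)" using C by simp
    qed
    also have "\<dots> = ennreal C * ennreal (exp (C * n + C)) + ennreal (C * n + C)"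
      using C n by (simp add: ennreal_mult' ennreal_plus)
    finally show ?thesis .
  qed
  with C show ?thesis unfolding preceq_def by (intro exI[of _ C]) auto
qed

end

text \<open>The stability of the divergence allows one to pass to \<open>\<delta> \<le> 1/4\<close> and to a \<open>\<gamma>\<close> that exceeds the scale \<open>D\<close> of
  the presentation. The generating set in the hypothesis on the ends and the given one
  may differ; only the group-theoretic conclusions are carried over from the former.\<close>

theorem lemma6p15:
  fixes G :: "('a, 'b) monoid_scheme" and S :: "'a set" and \<delta>\<^sub>0 \<gamma>\<^sub>0 :: real
  assumes "group G"
    and "finitely_presented G"
    and "one_ended_group G"
    and "divergence_constants G \<delta>\<^sub>0 \<gamma>\<^sub>0"
    and "finite_generating_set G S"
  shows "cayley_Div G S \<gamma>\<^sub>0 \<delta>\<^sub>0 \<preceq> (\<lambda>n. ennreal (exp n))"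
proof -
  obtain S' where S': "finite_generating_set G S'"
    "Metric_space.one_ended (cayley_space G S') (cayley_dist G S')"
    using assms(3) unfolding one_ended_group_def by blast
  interpret S': cayley_graph G S' using assms(1) S'(1) by (simp add: cayley_graph_def cayley_graph_axioms_def)
  interpret cayley_graph G S using assms(1,5) by (simp add: cayley_graph_def cayley_graph_axioms_def)
  obtain D0 where "H1_trivial_at D0"
    using finitely_presented_imp_H1_trivial[OF assms(2)] by metis
  then obtain D where D: "H1_trivial_at D" "1 \<le> D"
    using H1_trivial_at_mono[of D0 "max D0 1"] by (metis max.cobounded1 max.cobounded2)
  define \<delta> where "\<delta> = min \<delta>\<^sub>0 (1/4)"
  define \<gamma> where "\<gamma> = max \<gamma>\<^sub>0 (real D + 4)"
  have \<delta>\<gamma>: "0 < \<delta>" "\<delta> \<le> \<delta>\<^sub>0" "\<gamma>\<^sub>0 \<le> \<gamma>"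
    using assms(4) by (auto simp: divergence_constants_def \<delta>_def \<gamma>_def)
  then have "cayley_Div G S \<gamma> \<delta> \<asymp> cayley_Div G S \<gamma>\<^sub>0 \<delta>\<^sub>0"
    using assms(4,5) unfolding divergence_constants_def by blast
  then have "cayley_Div G S \<gamma>\<^sub>0 \<delta>\<^sub>0 \<preceq> cayley_Div G S \<gamma> \<delta>"
    by (simp add: asympeq_def)
  moreover have "cayley_Div G S \<gamma> \<delta> \<preceq> (\<lambda>n. ennreal (exp n))"
    unfolding cayley_Div_def
    by (rule Div_exponential[OF D S'.one_ended_imp_infinite S'.one_ended_imp_property])
      (use S'(2) \<delta>\<gamma> in \<open>auto simp: \<delta>_def \<gamma>_def\<close>)
  moreover have "mono (\<lambda>n. ennreal (exp n))" by (intro monoI ennreal_leI) simp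
  ultimately show ?thesis by (rule preceq_trans)
qed

end
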